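(* Let $k$ be a field and let $q\in k$ be a primitive $\ell$-th root of unity. The quantum Grassmannian $\mathcal{O}_q=\mathcal{O}_q[\operatorname{Gr}(2,4)]$ is not a Frobenius extension of its $\ell$-centre $Z_0$.
   Context: The algebra of quantum matrices $\mathcal{O}_q[\operatorname{Mat}(2\times4,k)]$ is the $k$-algebra generated by $X_{i,j}$ ($1\leq i\leq2$, $1\leq j\leq4$) with relations $X_{i,j}X_{i,l}=qX_{i,l}X_{i,j}$ for $j<l$; $X_{1,j}X_{2,j}=qX_{2,j}X_{1,j}$; $X_{1,l}X_{2,j}=X_{2,j}X_{1,l}$ for $j<l$; $X_{1,j}X_{2,l}-X_{2,l}X_{1,j}=(q-q^{-1})X_{1,l}X_{2,j}$ for $j<l$. The maximal quantum minors are $[jl]=X_{1,j}X_{2,l}-qX_{1,l}X_{2,j}$ for $1\leq j<l\leq4$. $\mathcal{O}_q[\operatorname{Gr}(2,4)]$ is the subalgebra generated by the maximal quantum minors, and its $\ell$-centre $Z_0$ is the (central) subalgebra generated by the $\ell$-th powers of the maximal quantum minors. For $k$-algebras $\mathcal{S}\subseteq\mathcal{R}$, $\operatorname{Hom}_{\mathcal{S}}(\mathcal{R},\mathcal{S})$ (left $\mathcal{S}$-module maps) is an $\mathcal{R}$-$\mathcal{S}$-bimodule by $(f.s)(r)=f(r)s$ and $(q.f)(r)=f(rq)$. The inclusion is a Frobenius extension if $\mathcal{R}$ is a projective left $\mathcal{S}$-module and $\mathcal{R}\cong\operatorname{Hom}_{\mathcal{S}}(\mathcal{R},\mathcal{S})$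 as $\mathcal{R}$-$\mathcal{S}$-bimodules.
   Formalization: The formal theorem assumes ℓ ≥ 2; for ℓ = 1 (so q = 1) the ℓ-centre Z_0 equals O_q, and every ring is a Frobenius extension of itself, so the claim fails in that case. *)

theory Defs
  imports "HOL-Algebra.Generated_Rings"
begin

definition primitive_root_of_unity :: "nat \<Rightarrow> 'k::field \<Rightarrow> bool" where
  "primitive_root_of_unity n q \<longleftrightarrow> n > 0 \<and> q ^ n = 1 \<and> (\<forall>m. 0 < m \<and> m < n \<longrightarrow> q ^ m \<noteq> 1)"


section \<open>Free algebras\<close>

text \<open>
  A noncommutative polynomial is given by its coefficient function on words. A word splits
  into a prefix and a suffix once for each length of the prefix, so the product is the one
  that concatenates words.
\<close>

definition free_algebra :: "'x set \<Rightarrow> ('x list \<Rightarrow> 'k::comm_ring_1) ring" where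
  "free_algebra X =
    \<lparr>carrier = {f. finite {w. f w \<noteq> 0} \<and> {w. f w \<noteq> 0} \<subseteq> lists X},
     mult = (\<lambda>f g w. \<Sum>i\<le>length w. f (take i w) * g (drop i w)),
     one = (\<lambda>w. if w = [] then 1 else 0),
     zero = (\<lambda>w. 0),
     add = (\<lambda>f g w. f w + g w)\<rparr>"

definition monomial :: "'k::comm_ring_1 \<Rightarrow> 'x list \<Rightarrow> 'x list \<Rightarrow> 'k" where
  "monomial c w = (\<lambda>v. if v = w then c else 0)"

lemma monomial_closed: "set w \<subseteq> X \<Longrightarrow> monomial c w \<in> carrier (free_algebra X)"
proof -
  assume "set w \<subseteq> X"
  moreover have "{v. monomial c w v \<noteq> 0} \<subseteq> {w}" by (auto simp: monomial_def)
  ultimately show ?thesis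
    unfolding free_algebra_def
    by (auto simp: monomial_def in_lists_conv_set intro: finite_subset split: if_splits)
qed

lemma ring_free_algebra: "ring (free_algebra X :: ('x list \<Rightarrow> 'k::comm_ring_1) ring)"
proof -
  let ?F = "free_algebra X :: ('x list \<Rightarrow> 'k) ring"
  define mul where "mul = (\<lambda>(f::'x list \<Rightarrow> 'k) g w. \<Sum>i\<le>length w. f (take i w) * g (drop i w))"
  have F: "carrier ?F = {f. finite {w. f w \<noteq> 0} \<and> {w. f w \<noteq> 0} \<subseteq> lists X}"
    "monoid.mult ?F = mul" "one ?F = (\<lambda>w. if w = [] then 1 else 0)"
    "zero ?F = (\<lambda>w. 0)" "add ?F = (\<lambda>f g w. f w + g w)"
    by (simp_all add: free_algebra_def mul_def)
  have add_cl: "(\<lambda>w. f w + g w) \<in> carrier ?F" if "f \<in> carrier ?F" "g \<in> carrier ?F" for f g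
  proof -
    have "{w. f w + g w \<noteq> 0} \<subseteq> {w. f w \<noteq> 0} \<union> {w. g w \<noteq> 0}" by auto
    then show ?thesis using that unfolding F by (auto intro: finite_subset)
  qed
  have mul_cl: "mul f g \<in> carrier ?F" if "f \<in> carrier ?F" "g \<in> carrier ?F" for f g
  proof -
    have sub: "{w. mul f g w \<noteq> 0} \<subseteq> (\<lambda>(u, v). u @ v) ` ({w. f w \<noteq> 0} \<times> {w. g w \<noteq> 0})"
    proof
      fix w assume "w \<in> {w. mul f g w \<noteq> 0}"
      then have "(\<Sum>i\<le>length w. f (take i w) * g (drop i w)) \<noteq> 0" by (simp add: mul_def)
      then obtain i where "f (take i w) * g (drop i w) \<noteq> 0"
        by (rule sum.not_neutral_contains_not_neutral)
      then have "f (take i w) \<noteq> 0" "g (drop i w) \<noteq> 0" by auto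
      then show "w \<in> (\<lambda>(u, v). u @ v) ` ({w. f w \<noteq> 0} \<times> {w. g w \<noteq> 0})"
        by (intro image_eqI[of _ _ "(take i w, drop i w)"]) auto
    qed
    moreover have "finite ({w. f w \<noteq> 0} \<times> {w. g w \<noteq> 0})" using that unfolding F by auto
    ultimately have "finite {w. mul f g w \<noteq> 0}" by (meson finite_imageI finite_subset)
    moreover have "{w. mul f g w \<noteq> 0} \<subseteq> lists X" using sub that unfolding F by fastforce
    ultimately show ?thesis unfolding F by simp
  qed
  have assoc: "mul (mul f g) h = mul f (mul g h)" for f g h
  proof
    fix w :: "'x list"
    let ?n = "length w"
    let ?t = "\<lambda>(j, i). f (take j w) * g (take (i - j) (drop j w)) * h (drop i w)"
    have "mul (mul f g) h w = (\<Sum>i\<le>?n. \<Sum>j\<le>i. ?t (j, i))"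
      unfolding mul_def
      by (auto simp: sum_distrib_right min_def take_take drop_take intro!: sum.cong)
    also have "\<dots> = sum ?t (SIGMA j:{..?n}. {j..?n})"
      by (subst sum.Sigma, simp, simp,
          rule sum.reindex_bij_witness[where i = prod.swap and j = prod.swap]) auto
    also have "\<dots> = (\<Sum>j\<le>?n. \<Sum>i\<in>{j..?n}. ?t (j, i))"
      by (subst sum.Sigma) auto
    also have "\<dots> = (\<Sum>j\<le>?n. \<Sum>i\<le>?n - j. ?t (j, j + i))"
    proof (rule sum.cong[OF refl])
      fix j assume "j \<in> {..?n}"
      then show "(\<Sum>i\<in>{j..?n}. ?t (j, i)) = (\<Sum>i\<le>?n - j. ?t (j, j + i))"
        by (intro sum.reindex_bij_witness[where i = "\<lambda>i. j + i" and j = "\<lambda>i. i - j"]) auto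
    qed
    also have "\<dots> = mul f (mul g h) w"
      unfolding mul_def
      by (auto simp: sum_distrib_left mult.assoc add.commute intro!: sum.cong)
    finally show "mul (mul f g) h w = mul f (mul g h) w" .
  qed
  have one_l: "mul (\<lambda>w. if w = [] then 1 else 0) f = f" for f
  proof
    fix w :: "'x list"
    have "mul (\<lambda>w. if w = [] then 1 else 0) f w = (\<Sum>i\<le>length w. if i = 0 then f w else 0)"
      unfolding mul_def by (intro sum.cong) auto
    then show "mul (\<lambda>w. if w = [] then 1 else 0) f w = f w" by simp
  qed
  have one_r: "mul f (\<lambda>w. if w = [] then 1 else 0) = f" for f
  proof
    fix w :: "'x list"
    have "mul f (\<lambda>w. if w = [] then 1 else 0) w = (\<Sum>i\<le>length w. if i = length w then f w else 0)"
      unfolding mul_def by (intro sum.cong) auto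
    then show "mul f (\<lambda>w. if w = [] then 1 else 0) w = f w" by simp
  qed
  have "abelian_group ?F"
  proof (rule abelian_groupI)
    fix f assume f: "f \<in> carrier ?F"
    then have "(\<lambda>w. - f w) \<in> carrier ?F" unfolding F by simp
    then show "\<exists>g\<in>carrier ?F. g \<oplus>\<^bsub>?F\<^esub> f = \<zero>\<^bsub>?F\<^esub>"
      by (rule bexI[rotated]) (simp add: F)
  qed (use add_cl in \<open>auto simp: F add.assoc add.commute\<close>)
  moreover have "monoid ?F"
  proof (rule monoidI)
    have "{w::'x list. (if w = [] then 1 else 0) \<noteq> (0::'k)} \<subseteq> {[]}" by auto
    then show "\<one>\<^bsub>?F\<^esub> \<in> carrier ?F" unfolding F by (auto intro: finite_subset)
  qed (use mul_cl in \<open>auto simp: F assoc one_l one_r\<close>)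
  moreover have "mul (\<lambda>w. f w + g w) h = (\<lambda>w. mul f h w + mul g h w)"
    and "mul h (\<lambda>w. f w + g w) = (\<lambda>w. mul h f w + mul h g w)" for f g h
    by (auto simp: mul_def fun_eq_iff distrib_left distrib_right sum.distrib)
  ultimately show ?thesis by (intro ringI) (auto simp: F)
qed


section \<open>Quantum matrices and the quantum Grassmannian\<close>

text \<open>The pair \<open>(i, j)\<close> stands for the generator \<open>X\<^sub>i\<^sub>,\<^sub>j\<close>.\<close>

definition qmat_free :: "((nat \<times> nat) list \<Rightarrow> 'k::field) ring" where
  "qmat_free = free_algebra ({1..2} \<times> {1..4})"

definition qmat_relations :: "'k::field \<Rightarrow> ((nat \<times> nat) list \<Rightarrow> 'k) set" where
  "qmat_relations q =
    (let F = qmat_free; X = (\<lambda>i j. monomial 1 [(i, j)]); c = (\<lambda>a. monomial a []) in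
      {X i j \<otimes>\<^bsub>F\<^esub> X i l \<ominus>\<^bsub>F\<^esub> c q \<otimes>\<^bsub>F\<^esub> X i l \<otimes>\<^bsub>F\<^esub> X i j
        | i j l. 1 \<le> i \<and> i \<le> 2 \<and> 1 \<le> j \<and> j < l \<and> l \<le> 4}
      \<union> {X 1 j \<otimes>\<^bsub>F\<^esub> X 2 j \<ominus>\<^bsub>F\<^esub> c q \<otimes>\<^bsub>F\<^esub> X 2 j \<otimes>\<^bsub>F\<^esub> X 1 j
        | j. 1 \<le> j \<and> j \<le> 4}
      \<union> {X 1 l \<otimes>\<^bsub>F\<^esub> X 2 j \<ominus>\<^bsub>F\<^esub> X 2 j \<otimes>\<^bsub>F\<^esub> X 1 l
        | j l. 1 \<le> j \<and> j < l \<and> l \<le> 4}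
      \<union> {(X 1 j \<otimes>\<^bsub>F\<^esub> X 2 l \<ominus>\<^bsub>F\<^esub> X 2 l \<otimes>\<^bsub>F\<^esub> X 1 j)
            \<ominus>\<^bsub>F\<^esub> c (q - inverse q) \<otimes>\<^bsub>F\<^esub> X 1 l \<otimes>\<^bsub>F\<^esub> X 2 j
        | j l. 1 \<le> j \<and> j < l \<and> l \<le> 4})"

definition qmat_ideal :: "'k::field \<Rightarrow> ((nat \<times> nat) list \<Rightarrow> 'k) set" where
  "qmat_ideal q = Idl\<^bsub>qmat_free\<^esub> (qmat_relations q)"

definition qmat :: "'k::field \<Rightarrow> ((nat \<times> nat) list \<Rightarrow> 'k) set ring" where
  "qmat q = qmat_free Quot (qmat_ideal q)"

definition qmat_gen :: "'k::field \<Rightarrow> nat \<Rightarrow> nat \<Rightarrow> ((nat \<times> nat) list \<Rightarrow> 'k) set" where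
  "qmat_gen q i j = qmat_ideal q +>\<^bsub>qmat_free\<^esub> monomial 1 [(i, j)]"

text \<open>The structure map of the algebra, from the field into the quantum matrices.\<close>

definition qmat_scalar :: "'k::field \<Rightarrow> 'k \<Rightarrow> ((nat \<times> nat) list \<Rightarrow> 'k) set" where
  "qmat_scalar q a = qmat_ideal q +>\<^bsub>qmat_free\<^esub> monomial a []"

definition qmat_subalgebra_generated ::
    "'k::field \<Rightarrow> ((nat \<times> nat) list \<Rightarrow> 'k) set set \<Rightarrow> ((nat \<times> nat) list \<Rightarrow> 'k) set set" where
  "qmat_subalgebra_generated q H = generate_ring (qmat q) (range (qmat_scalar q) \<union> H)"

definition qminor :: "'k::field \<Rightarrow> nat \<Rightarrow> nat \<Rightarrow> ((nat \<times> nat) list \<Rightarrow> 'k) set" where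
  "qminor q j l =
    qmat_gen q 1 j \<otimes>\<^bsub>qmat q\<^esub> qmat_gen q 2 l
      \<ominus>\<^bsub>qmat q\<^esub> qmat_scalar q q \<otimes>\<^bsub>qmat q\<^esub> qmat_gen q 1 l \<otimes>\<^bsub>qmat q\<^esub> qmat_gen q 2 j"

definition qgrassmannian :: "'k::field \<Rightarrow> ((nat \<times> nat) list \<Rightarrow> 'k) set ring" where
  "qgrassmannian q = (qmat q)
    \<lparr>carrier := qmat_subalgebra_generated q {qminor q j l | j l. 1 \<le> j \<and> j < l \<and> l \<le> 4}\<rparr>"

definition l_centre :: "'k::field \<Rightarrow> nat \<Rightarrow> ((nat \<times> nat) list \<Rightarrow> 'k) set set" where
  "l_centre q n = qmat_subalgebra_generated q
    {qminor q j l [^]\<^bsub>qmat q\<^esub> n | j l. 1 \<le> j \<and> j < l \<and> l \<le> 4}"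

lemma ring_qmat_free: "ring (qmat_free :: ((nat \<times> nat) list \<Rightarrow> 'k::field) ring)"
  unfolding qmat_free_def by (rule ring_free_algebra)

lemma qmat_relations_closed: "qmat_relations q \<subseteq> carrier qmat_free"
proof -
  interpret F: ring "qmat_free :: ((nat \<times> nat) list \<Rightarrow> 'a) ring" by (rule ring_qmat_free)
  have X: "monomial (1::'a) [(i, j)] \<in> carrier qmat_free" if "1 \<le> i" "i \<le> 2" "1 \<le> j" "j \<le> 4" for i j
    unfolding qmat_free_def using that by (intro monomial_closed) auto
  have c: "monomial (a::'a) [] \<in> carrier qmat_free" for a
    unfolding qmat_free_def by (intro monomial_closed) auto
  show ?thesis
    unfolding qmat_relations_def Let_def
    by (auto intro!: F.minus_closed F.m_closed X c)
qed

lemma ideal_qmat_ideal: "ideal (qmat_ideal q) qmat_free"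
  unfolding qmat_ideal_def
  by (rule ring.genideal_ideal[OF ring_qmat_free qmat_relations_closed])

lemma ring_qmat: "ring (qmat q)"
  unfolding qmat_def by (rule ideal.quotient_is_ring[OF ideal_qmat_ideal])

lemma coset_closed: "f \<in> carrier qmat_free \<Longrightarrow> qmat_ideal q +>\<^bsub>qmat_free\<^esub> f \<in> carrier (qmat q)"
  unfolding qmat_def FactRing_def A_RCOSETS_def' by auto

lemma qmat_scalar_closed: "qmat_scalar q a \<in> carrier (qmat q)"
  unfolding qmat_scalar_def by (rule coset_closed) (simp add: qmat_free_def monomial_closed)

lemma qmat_gen_closed:
  "1 \<le> i \<Longrightarrow> i \<le> 2 \<Longrightarrow> 1 \<le> j \<Longrightarrow> j \<le> 4 \<Longrightarrow> qmat_gen q i j \<in> carrier (qmat q)"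
  unfolding qmat_gen_def by (rule coset_closed) (simp add: qmat_free_def monomial_closed)

lemma qminor_closed: "1 \<le> j \<Longrightarrow> j < l \<Longrightarrow> l \<le> 4 \<Longrightarrow> qminor q j l \<in> carrier (qmat q)"
proof -
  interpret ring "qmat q" by (rule ring_qmat)
  assume "1 \<le> j" "j < l" "l \<le> 4"
  then show ?thesis
    unfolding qminor_def by (intro minus_closed m_closed qmat_gen_closed qmat_scalar_closed) auto
qed

lemma subring_qmat_subalgebra_generated:
  "H \<subseteq> carrier (qmat q) \<Longrightarrow> subring (qmat_subalgebra_generated q H) (qmat q)"
  unfolding qmat_subalgebra_generated_def
  by (rule ring.generate_ring_is_subring[OF ring_qmat]) (auto intro: qmat_scalar_closed)

lemma ring_qgrassmannian: "ring (qgrassmannian q)"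
  unfolding qgrassmannian_def
  by (rule ring.subring_is_ring[OF ring_qmat subring_qmat_subalgebra_generated])
    (auto intro: qminor_closed)

lemma subring_l_centre: "subring (l_centre q n) (qgrassmannian q)"
proof -
  interpret M: ring "qmat q" by (rule ring_qmat)
  let ?P = "{qminor q j l [^]\<^bsub>qmat q\<^esub> n | j l. 1 \<le> j \<and> j < l \<and> l \<le> 4}"
  let ?D = "{qminor q j l | j l. 1 \<le> j \<and> j < l \<and> l \<le> 4}"
  have D: "subring (qmat_subalgebra_generated q ?D) (qmat q)"
    by (rule subring_qmat_subalgebra_generated) (auto intro: qminor_closed)
  have P: "?P \<subseteq> carrier (qmat q)" by (auto intro!: M.nat_pow_closed qminor_closed)
  have "range (qmat_scalar q) \<union> ?P \<subseteq> qmat_subalgebra_generated q ?D"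
  proof -
    have "x [^]\<^bsub>qmat q\<^esub> n \<in> qmat_subalgebra_generated q ?D"
      if x: "x \<in> qmat_subalgebra_generated q ?D" for x
      using subringE(3)[OF D] subringE(6)[OF D _ x] by (induction n) simp_all
    moreover have "?D \<union> range (qmat_scalar q) \<subseteq> qmat_subalgebra_generated q ?D"
      unfolding qmat_subalgebra_generated_def by (auto intro: generate_ring.incl)
    ultimately show ?thesis by auto
  qed
  then have sub: "l_centre q n \<subseteq> qmat_subalgebra_generated q ?D"
    unfolding l_centre_def qmat_subalgebra_generated_def[of q ?P]
    by (intro M.generate_ring_min_subring1[OF _ D]) (use P in \<open>auto intro: qmat_scalar_closed\<close>)
  have "ring ((qmat q)\<lparr>carrier := l_centre q n\<rparr>)"
    unfolding l_centre_def
    by (rule M.subring_is_ring[OF subring_qmat_subalgebra_generated[OF P]])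
  then have "ring ((qgrassmannian q)\<lparr>carrier := l_centre q n\<rparr>)"
    by (simp add: qgrassmannian_def)
  moreover have "l_centre q n \<subseteq> carrier (qgrassmannian q)"
    using sub by (simp add: qgrassmannian_def)
  ultimately show ?thesis
    using ring.subring_iff[OF ring_qgrassmannian] by blast
qed


section \<open>Frobenius extensions\<close>

text \<open>
  Left modules over a ring that need not be commutative are carried by the record type of the
  library; its multiplication and unit play no part. Linear maps are extensional functions, so
  that they agree as soon as they agree on the carrier.
\<close>

definition linear_maps ::
    "('s, 'x) ring_scheme \<Rightarrow> ('s, 'm, 'y) module_scheme \<Rightarrow> ('s, 'n, 'z) module_scheme \<Rightarrow> ('m \<Rightarrow> 'n) set" where
  "linear_maps S M N = {h \<in> carrier M \<rightarrow>\<^sub>E carrier N.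
    (\<forall>x\<in>carrier M. \<forall>y\<in>carrier M. h (x \<oplus>\<^bsub>M\<^esub> y) = h x \<oplus>\<^bsub>N\<^esub> h y) \<and>
    (\<forall>s\<in>carrier S. \<forall>x\<in>carrier M. h (s \<odot>\<^bsub>M\<^esub> x) = s \<odot>\<^bsub>N\<^esub> h x)}"

definition free_left_module :: "('s, 'x) ring_scheme \<Rightarrow> 'i set \<Rightarrow> ('s, 'i \<Rightarrow> 's) module" where
  "free_left_module S I =
    \<lparr>carrier = {v. (\<forall>i. v i \<in> carrier S) \<and> (\<forall>i. i \<notin> I \<longrightarrow> v i = \<zero>\<^bsub>S\<^esub>) \<and> finite {i. v i \<noteq> \<zero>\<^bsub>S\<^esub>}},
     mult = undefined, one = undefined,
     zero = (\<lambda>i. \<zero>\<^bsub>S\<^esub>),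
     add = (\<lambda>v w i. v i \<oplus>\<^bsub>S\<^esub> w i),
     smult = (\<lambda>s v i. s \<otimes>\<^bsub>S\<^esub> v i)\<rparr>"

text \<open>
  A left module is projective if it is a direct summand (equivalently, a linear retract) of a
  free module. Taking the basis inside the type of the elements of the module is no restriction:
  a summand of some free module is also one of the free module on its own elements.
\<close>

definition projective_left_module :: "('s, 'x) ring_scheme \<Rightarrow> ('s, 'm, 'y) module_scheme \<Rightarrow> bool" where
  "projective_left_module S M \<longleftrightarrow>
    (\<exists>I :: 'm set. \<exists>\<iota> \<in> linear_maps S M (free_left_module S I).
      \<exists>\<pi> \<in> linear_maps S (free_left_module S I) M. \<forall>x\<in>carrier M. \<pi> (\<iota> x) = x)"

record ('r, 'm, 's) bimodule = "('r, 'm) module" +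
  smult_right :: "'m \<Rightarrow> 's \<Rightarrow> 'm"

definition bimodule_isos ::
    "('r, 'x) ring_scheme \<Rightarrow> ('s, 'y) ring_scheme \<Rightarrow> ('r, 'm, 's, 'u) bimodule_scheme
      \<Rightarrow> ('r, 'n, 's, 'v) bimodule_scheme \<Rightarrow> ('m \<Rightarrow> 'n) set" where
  "bimodule_isos R S M N = {h. bij_betw h (carrier M) (carrier N) \<and>
    (\<forall>x\<in>carrier M. \<forall>y\<in>carrier M. h (x \<oplus>\<^bsub>M\<^esub> y) = h x \<oplus>\<^bsub>N\<^esub> h y) \<and>
    (\<forall>r\<in>carrier R. \<forall>x\<in>carrier M. h (r \<odot>\<^bsub>M\<^esub> x) = r \<odot>\<^bsub>N\<^esub> h x) \<and>
    (\<forall>s\<in>carrier S. \<forall>x\<in>carrier M. h (smult_right M x s) = smult_right N (h x) s)}"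

text \<open>
  A ring acting on itself by multiplication on both sides; restricting the scalars to a
  subring only changes the sets over which they range.
\<close>

definition ring_bimodule :: "('a, 'x) ring_scheme \<Rightarrow> ('a, 'a, 'a) bimodule" where
  "ring_bimodule R =
    \<lparr>carrier = carrier R, mult = monoid.mult R, one = \<one>\<^bsub>R\<^esub>, zero = \<zero>\<^bsub>R\<^esub>, add = add R,
     smult = monoid.mult R, smult_right = monoid.mult R\<rparr>"

definition hom_bimodule :: "('a, 'x) ring_scheme \<Rightarrow> 'a set \<Rightarrow> ('a, 'a \<Rightarrow> 'a, 'a) bimodule" where
  "hom_bimodule R S =
    \<lparr>carrier = linear_maps (R\<lparr>carrier := S\<rparr>) (ring_bimodule R) (ring_bimodule (R\<lparr>carrier := S\<rparr>)),
     mult = undefined, one = undefined,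
     zero = (\<lambda>x\<in>carrier R. \<zero>\<^bsub>R\<^esub>),
     add = (\<lambda>f g. \<lambda>x\<in>carrier R. f x \<oplus>\<^bsub>R\<^esub> g x),
     smult = (\<lambda>r f. \<lambda>x\<in>carrier R. f (x \<otimes>\<^bsub>R\<^esub> r)),
     smult_right = (\<lambda>f s. \<lambda>x\<in>carrier R. f x \<otimes>\<^bsub>R\<^esub> s)\<rparr>"

text \<open>
  Meant for a ring \<open>R\<close> and a subring \<open>S\<close> of it. If both are algebras over a field then \<open>S\<close>
  contains the scalars, so linearity over the field is part of linearity over \<open>S\<close>.
\<close>

definition frobenius_extension :: "('a, 'x) ring_scheme \<Rightarrow> 'a set \<Rightarrow> bool" where
  "frobenius_extension R S \<longleftrightarrow>
    projective_left_module (R\<lparr>carrier := S\<rparr>) (ring_bimodule R) \<and>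
    bimodule_isos R (R\<lparr>carrier := S\<rparr>) (ring_bimodule R) (hom_bimodule R S) \<noteq> {}"

end

theory Submission
  imports Defs
begin

text \<open>
  The extension fails to be Frobenius because \<open>\<O>\<^sub>q\<close> is not projective over \<open>Z\<^sub>0\<close>. Write \<open>z\<^sub>i\<^sub>j\<close> for the
  \<open>l\<close>-th power of the minor \<open>[ij]\<close> and consider \<open>r = [13]\<^sup>l\<^sup>-\<^sup>1 [14]\<^sup>l\<^sup>-\<^sup>1 [34]\<close>.

  The minors \<open>[12]\<close>, \<open>[13]\<close>, \<open>[14]\<close> commute up to powers of \<open>q\<close>, and
  \<open>[12][34] = q[13][24] - q\<^sup>2[14][23]\<close>. Hence \<open>z\<^sub>1\<^sub>2 r = z\<^sub>1\<^sub>3 A + z\<^sub>1\<^sub>4 B\<close> for some \<open>A\<close> and \<open>B\<close> in \<open>\<O>\<^sub>q\<close>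
  (lemmas \<open>minor_row\<close>, \<open>Pluecker\<close>, \<open>minor_syzygy\<close>).

  Suppose that \<open>\<O>\<^sub>q\<close> is projective. Then there are linear maps \<open>\<phi>\<^sub>i\<close> from \<open>\<O>\<^sub>q\<close> to \<open>Z\<^sub>0\<close> and
  elements \<open>p\<^sub>i\<close> such that \<open>r\<close> is the sum of the \<open>\<phi>\<^sub>i(r) p\<^sub>i\<close>. Applying \<open>\<phi>\<^sub>i\<close> to the relation gives
  \<open>z\<^sub>1\<^sub>2 \<phi>\<^sub>i(r) = z\<^sub>1\<^sub>3 \<phi>\<^sub>i(A) + z\<^sub>1\<^sub>4 \<phi>\<^sub>i(B)\<close> in \<open>Z\<^sub>0\<close>. There is a representation of the quantum matrices in
  which \<open>[13]\<close> and \<open>[14]\<close> act by zero and \<open>[12]\<close> as multiplication by the variable on power series in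
  one variable; it shows that the constant term of \<open>\<phi>\<^sub>i(r)\<close> vanishes. So \<open>r\<close> would lie in the right ideal of \<open>\<O>\<^sub>q\<close> generated by
  all \<open>z\<^sub>i\<^sub>j\<close>.

  A second representation shows that it does not. It sends \<open>[13]\<close>, \<open>[14]\<close>, \<open>[34]\<close> to three
  variables that commute up to powers of \<open>q\<close>, and the other minors to zero. All monomials in the
  image of that right ideal are divisible by the \<open>l\<close>-th power of a variable, whereas the image of
  \<open>r\<close> is a monomial with exponents \<open>l - 1\<close>, \<open>l - 1\<close> and \<open>1\<close>. What the two representations detect of
  an element of \<open>Z\<^sub>0\<close> is the content of \<open>l_centre_constant_term\<close>.
\<close>

section \<open>Rings with central scalars\<close>

text \<open>
  An algebra over a field, presented as in the definition of the quantum matrices: the field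
  enters through a map into the centre and not as a separate module structure.
\<close>

locale central_scalars = ring R for R (structure) +
  fixes s :: "'k::field \<Rightarrow> 'a"
  assumes s_closed [simp, intro]: "s a \<in> carrier R"
    and s_add: "s (a + b) = s a \<oplus> s b"
    and s_mult: "s (a * b) = s a \<otimes> s b"
    and s_one: "s 1 = \<one>"
    and s_central: "x \<in> carrier R \<Longrightarrow> x \<otimes> s a = s a \<otimes> x"
begin

definition smul :: "'k \<Rightarrow> 'a \<Rightarrow> 'a" (infixr "\<cdot>" 75) where
  "a \<cdot> x = s a \<otimes> x"

lemma smul_closed [simp, intro]: "x \<in> carrier R \<Longrightarrow> a \<cdot> x \<in> carrier R"
  by (simp add: smul_def)

lemma smul_add: "x \<in> carrier R \<Longrightarrow> y \<in> carrier R \<Longrightarrow> a \<cdot> (x \<oplus> y) = a \<cdot> x \<oplus> a \<cdot> y"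
  by (simp add: smul_def r_distr)

lemma add_smul: "x \<in> carrier R \<Longrightarrow> (a + b) \<cdot> x = a \<cdot> x \<oplus> b \<cdot> x"
  by (simp add: smul_def s_add l_distr)

lemma smul_smul: "x \<in> carrier R \<Longrightarrow> a \<cdot> b \<cdot> x = (a * b) \<cdot> x"
  by (simp add: smul_def s_mult m_assoc)

lemma one_smul: "x \<in> carrier R \<Longrightarrow> 1 \<cdot> x = x"
  by (simp add: smul_def s_one)

lemma smul_mult: "x \<in> carrier R \<Longrightarrow> y \<in> carrier R \<Longrightarrow> a \<cdot> x \<otimes> y = a \<cdot> (x \<otimes> y)"
  by (simp add: smul_def m_assoc)

lemma mult_smul: "x \<in> carrier R \<Longrightarrow> y \<in> carrier R \<Longrightarrow> x \<otimes> (a \<cdot> y) = a \<cdot> (x \<otimes> y)"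
  by (simp add: smul_def m_assoc [symmetric] s_central)

lemma s_zero: "s 0 = \<zero>"
  using s_add [of 0 0] add.l_cancel_one [of "s 0" "s 0"] by simp

lemma zero_smul: "x \<in> carrier R \<Longrightarrow> 0 \<cdot> x = \<zero>"
  by (simp add: smul_def s_zero)

lemma minus_eq_smul: "x \<in> carrier R \<Longrightarrow> \<ominus> x = (- 1) \<cdot> x"
proof -
  assume x: "x \<in> carrier R"
  have "(- 1) \<cdot> x \<oplus> x = (- 1 + 1) \<cdot> x"
    by (subst add_smul) (simp_all add: x one_smul)
  then have "(- 1) \<cdot> x \<oplus> x = \<zero>" by (simp add: smul_def s_zero x)
  then show ?thesis by (rule minus_equality) (simp_all add: x)
qed

lemma diff_eq_smul: "x \<in> carrier R \<Longrightarrow> y \<in> carrier R \<Longrightarrow> x \<ominus> y = x \<oplus> (- 1) \<cdot> y"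
  by (simp add: a_minus_def minus_eq_smul)

lemma diff_smul: "x \<in> carrier R \<Longrightarrow> y \<in> carrier R \<Longrightarrow> x \<ominus> a \<cdot> y = x \<oplus> (- a) \<cdot> y"
  by (simp add: diff_eq_smul smul_smul)

text \<open>
  Turns a rule for reordering two adjacent factors into one that still applies when the product
  is right-nested and further factors follow.
\<close>

lemma mult_left_extend:
  "\<lbrakk>x \<otimes> y = c \<cdot> (x' \<otimes> y'); x \<in> carrier R; y \<in> carrier R; x' \<in> carrier R; y' \<in> carrier R; z \<in> carrier R\<rbrakk>
    \<Longrightarrow> x \<otimes> (y \<otimes> z) = c \<cdot> (x' \<otimes> (y' \<otimes> z))"
  by (metis m_assoc m_closed smul_mult)

lemma q_commute_power_right:
  assumes "x \<in> carrier R" "y \<in> carrier R" "x \<otimes> y = c \<cdot> (y \<otimes> x)"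
  shows "x \<otimes> y [^] (m::nat) = c ^ m \<cdot> (y [^] m \<otimes> x)"
proof (induction m)
  case 0
  then show ?case using assms by (simp add: one_smul)
next
  case (Suc m)
  have "x \<otimes> y [^] Suc m = (x \<otimes> y [^] m) \<otimes> y" using assms by (simp add: m_assoc)
  also have "\<dots> = c ^ m \<cdot> (y [^] m \<otimes> (x \<otimes> y))" using assms by (simp add: Suc smul_mult m_assoc)
  also have "\<dots> = c ^ Suc m \<cdot> (y [^] Suc m \<otimes> x)"
    using assms by (simp add: mult_smul smul_smul m_assoc mult.commute)
  finally show ?case .
qed

lemma q_commute_power_left:
  assumes "x \<in> carrier R" "y \<in> carrier R" "x \<otimes> y = c \<cdot> (y \<otimes> x)"
  shows "x [^] (n::nat) \<otimes> y = c ^ n \<cdot> (y \<otimes> x [^] n)"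
proof (induction n)
  case 0
  then show ?case using assms by (simp add: one_smul)
next
  case (Suc n)
  have "x [^] Suc n \<otimes> y = x [^] n \<otimes> (x \<otimes> y)" using assms by (simp add: m_assoc)
  also have "\<dots> = c \<cdot> ((x [^] n \<otimes> y) \<otimes> x)" using assms by (simp add: mult_smul m_assoc)
  also have "\<dots> = c ^ Suc n \<cdot> (y \<otimes> x [^] Suc n)"
    using assms by (simp add: Suc smul_mult smul_smul m_assoc)
  finally show ?case .
qed

lemma q_commute_powers:
  assumes "x \<in> carrier R" "y \<in> carrier R" "x \<otimes> y = c \<cdot> (y \<otimes> x)"
  shows "x [^] (n::nat) \<otimes> y [^] (m::nat) = (c ^ n) ^ m \<cdot> (y [^] m \<otimes> x [^] n)"
  using assms by (intro q_commute_power_right q_commute_power_left) auto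

end

section \<open>Minors of a quantum matrix with two rows\<close>

text \<open>
  The relations of a quantum matrix only mention the order of the columns, so the columns may be
  indexed by any linear order. The first row is \<open>X\<close>, the second \<open>Y\<close>.
\<close>

locale quantum_two_rows = central_scalars R s for R (structure) and s :: "'k::field \<Rightarrow> 'a" +
  fixes q :: 'k and J :: "'c::linorder set" and X Y :: "'c \<Rightarrow> 'a"
  assumes q_nonzero: "q \<noteq> 0"
    and X_closed [simp, intro]: "j \<in> J \<Longrightarrow> X j \<in> carrier R"
    and Y_closed [simp, intro]: "j \<in> J \<Longrightarrow> Y j \<in> carrier R"
    and X_row: "\<lbrakk>j \<in> J; l \<in> J; j < l\<rbrakk> \<Longrightarrow> X j \<otimes> X l = q \<cdot> (X l \<otimes> X j)"
    and Y_row: "\<lbrakk>j \<in> J; l \<in> J; j < l\<rbrakk> \<Longrightarrow> Y j \<otimes> Y l = q \<cdot> (Y l \<otimes> Y j)"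
    and col: "j \<in> J \<Longrightarrow> X j \<otimes> Y j = q \<cdot> (Y j \<otimes> X j)"
    and anti: "\<lbrakk>j \<in> J; l \<in> J; j < l\<rbrakk> \<Longrightarrow> X l \<otimes> Y j = Y j \<otimes> X l"
    and diag: "\<lbrakk>j \<in> J; l \<in> J; j < l\<rbrakk>
      \<Longrightarrow> X j \<otimes> Y l = Y l \<otimes> X j \<oplus> (q - inverse q) \<cdot> (X l \<otimes> Y j)"
begin

definition minor :: "'c \<Rightarrow> 'c \<Rightarrow> 'a" where
  "minor j l = X j \<otimes> Y l \<ominus> q \<cdot> (X l \<otimes> Y j)"

lemma minor_closed [simp, intro]: "j \<in> J \<Longrightarrow> l \<in> J \<Longrightarrow> minor j l \<in> carrier R"
  by (auto simp: minor_def intro!: minus_closed)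

lemma minor_eq: "j \<in> J \<Longrightarrow> l \<in> J \<Longrightarrow> minor j l = X j \<otimes> Y l \<oplus> (- q) \<cdot> (X l \<otimes> Y j)"
  by (simp add: minor_def diff_smul)

lemma q_commute_swap: "\<lbrakk>x \<otimes> y = q \<cdot> (y \<otimes> x); x \<in> carrier R; y \<in> carrier R\<rbrakk> \<Longrightarrow> y \<otimes> x = inverse q \<cdot> (x \<otimes> y)"
  by (simp add: smul_smul q_nonzero one_smul)

lemma XX_order: "\<lbrakk>j \<in> J; l \<in> J; j < l\<rbrakk> \<Longrightarrow> X l \<otimes> X j = inverse q \<cdot> (X j \<otimes> X l)"
  by (intro q_commute_swap X_row) auto

lemma YY_order: "\<lbrakk>j \<in> J; l \<in> J; j < l\<rbrakk> \<Longrightarrow> Y l \<otimes> Y j = inverse q \<cdot> (Y j \<otimes> Y l)"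
  by (intro q_commute_swap Y_row) auto

lemma YX_same: "j \<in> J \<Longrightarrow> Y j \<otimes> X j = inverse q \<cdot> (X j \<otimes> Y j)"
  by (intro q_commute_swap col) auto

lemma YX_less: "\<lbrakk>j \<in> J; l \<in> J; j < l\<rbrakk> \<Longrightarrow> Y j \<otimes> X l = X l \<otimes> Y j"
  by (simp add: anti)

lemma YX_greater:
  "\<lbrakk>j \<in> J; l \<in> J; j < l\<rbrakk> \<Longrightarrow> Y l \<otimes> X j = X j \<otimes> Y l \<oplus> (inverse q - q) \<cdot> (X l \<otimes> Y j)"
proof -
  assume *: "j \<in> J" "l \<in> J" "j < l"
  have "X j \<otimes> Y l \<oplus> (inverse q - q) \<cdot> (X l \<otimes> Y j)
    = Y l \<otimes> X j \<oplus> ((q - inverse q) \<cdot> (X l \<otimes> Y j) \<oplus> (inverse q - q) \<cdot> (X l \<otimes> Y j))"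
    using * by (simp add: diag a_assoc)
  also have "(q - inverse q) \<cdot> (X l \<otimes> Y j) \<oplus> (inverse q - q) \<cdot> (X l \<otimes> Y j) = \<zero>"
    using * by (subst add_smul [symmetric]) (simp_all add: smul_def s_zero)
  finally show ?thesis using * by simp
qed

lemma YX_greater_extend:
  "\<lbrakk>j \<in> J; l \<in> J; j < l; z \<in> carrier R\<rbrakk> \<Longrightarrow>
    Y l \<otimes> (X j \<otimes> z) = X j \<otimes> (Y l \<otimes> z) \<oplus> (inverse q - q) \<cdot> (X l \<otimes> (Y j \<otimes> z))"
  by (simp add: m_assoc [symmetric] YX_greater l_distr smul_mult)

lemma YX_less_extend:
  "\<lbrakk>j \<in> J; l \<in> J; j < l; z \<in> carrier R\<rbrakk> \<Longrightarrow> Y j \<otimes> (X l \<otimes> z) = X l \<otimes> (Y j \<otimes> z)"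
  by (simp add: m_assoc [symmetric] YX_less)

lemmas YX_same_extend = mult_left_extend [OF YX_same]
lemmas XX_order_extend = mult_left_extend [OF XX_order]
lemmas YY_order_extend = mult_left_extend [OF YY_order]

text \<open>
  As rewrite rules these bring a product of generators to a combination of ordered monomials:
  the first row before the second, and within each row the columns in increasing order. The
  only reordering rules that produce two terms are \<open>YX_greater\<close> and its extension, and both terms
  have the first row before the second.
\<close>

lemmas normal_order =
  m_assoc l_distr r_distr smul_add smul_mult mult_smul smul_smul
  XX_order YY_order YX_same YX_less YX_greater
  XX_order_extend YY_order_extend YX_same_extend YX_less_extend YX_greater_extend

text \<open>
  Both sides lie in the span of the six ordered monomials that contain each of the columns
  \<open>j, l, m, n\<close> once and take two of them from each row. Their coordinates, collected by the local
  function \<open>L\<close>, turn the identity into six identities in the field.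
\<close>

lemma Pluecker:
  assumes J: "j \<in> J" "l \<in> J" "m \<in> J" "n \<in> J" and less: "j < l" "l < m" "m < n"
  shows "minor j l \<otimes> minor m n = q \<cdot> (minor j m \<otimes> minor l n) \<oplus> (- (q ^ 2)) \<cdot> (minor j n \<otimes> minor l m)"
proof -
  have less': "j < m" "j < n" "l < n" using less by auto
  define L where "L a b c d e f =
    a \<cdot> (X j \<otimes> (X l \<otimes> (Y m \<otimes> Y n))) \<oplus> (b \<cdot> (X j \<otimes> (X m \<otimes> (Y l \<otimes> Y n))) \<oplus>
    (c \<cdot> (X j \<otimes> (X n \<otimes> (Y l \<otimes> Y m))) \<oplus> (d \<cdot> (X l \<otimes> (X m \<otimes> (Y j \<otimes> Y n))) \<oplus>
    (e \<cdot> (X l \<otimes> (X n \<otimes> (Y j \<otimes> Y m))) \<oplus> f \<cdot> (X m \<otimes> (X n \<otimes> (Y j \<otimes> Y l)))))))" for a b c d e f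
  have L_add: "L a b c d e f \<oplus> L a' b' c' d' e' f' = L (a + a') (b + b') (c + c') (d + d') (e + e') (f + f')"
    for a b c d e f a' b' c' d' e' f'
    using J by (simp add: L_def add_smul a_ac)
  have L_smul: "t \<cdot> L a b c d e f = L (t * a) (t * b) (t * c) (t * d) (t * e) (t * f)" for t a b c d e f
    using J by (simp add: L_def smul_add smul_smul)
  have monomials:
    "X j \<otimes> (X l \<otimes> (Y m \<otimes> Y n)) = L 1 0 0 0 0 0"
    "X j \<otimes> (X m \<otimes> (Y l \<otimes> Y n)) = L 0 1 0 0 0 0"
    "X j \<otimes> (X n \<otimes> (Y l \<otimes> Y m)) = L 0 0 1 0 0 0"
    "X l \<otimes> (X m \<otimes> (Y j \<otimes> Y n)) = L 0 0 0 1 0 0"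
    "X l \<otimes> (X n \<otimes> (Y j \<otimes> Y m)) = L 0 0 0 0 1 0"
    "X m \<otimes> (X n \<otimes> (Y j \<otimes> Y l)) = L 0 0 0 0 0 1"
    using J by (simp_all add: L_def one_smul zero_smul)
  note expand = minor_eq normal_order J less less'
  note collect = monomials L_add L_smul
  have 1: "minor j l \<otimes> minor m n = L 0 1 (- q) (- q) (q * q) 0"
    by (simp add: expand, simp add: collect)
  have 2: "minor j m \<otimes> minor l n = L 1 (inverse q - q) (- 1) (- 1) 0 (q * q)"
    by (simp add: expand, simp add: collect, simp add: q_nonzero)
  have 3: "minor j n \<otimes> minor l m = L (inverse q) (- 1) 0 0 (- 1) q"
    by (simp add: expand, simp add: collect, simp add: q_nonzero field_simps)
  show ?thesis by (simp add: 1 2 3 L_add L_smul power2_eq_square q_nonzero field_simps)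
qed

text \<open>
  A minor is a quantum determinant, hence it commutes with the entries of its own two columns.
\<close>

lemma minor_commutes_X:
  assumes J: "j \<in> J" "l \<in> J" "j < l"
  shows "minor j l \<otimes> X j = X j \<otimes> minor j l"
proof -
  \<comment> \<open>The first summand is the correction from moving \<open>Y l\<close> past \<open>X j\<close>, the second comes from
    reordering \<open>X l \<otimes> Y j \<otimes> X j\<close>.\<close>
  have "(inverse q - q) \<cdot> (X j \<otimes> (X l \<otimes> Y j)) \<oplus> (- (q * (inverse q * inverse q))) \<cdot> (X j \<otimes> (X l \<otimes> Y j))
    = (- q) \<cdot> (X j \<otimes> (X l \<otimes> Y j))"
    using J by (subst add_smul [symmetric]) (simp_all add: q_nonzero mult.assoc [symmetric])
  then show ?thesis using J by (simp add: minor_eq normal_order a_assoc)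
qed

lemma minor_commutes_Y:
  assumes "j \<in> J" "l \<in> J" "j < l"
  shows "minor j l \<otimes> Y j = Y j \<otimes> minor j l"
  by (simp add: minor_eq normal_order assms)

lemma minor_q_commutes_X:
  assumes "j \<in> J" "l \<in> J" "m \<in> J" "j < l" "l < m"
  shows "minor j l \<otimes> X m = q \<cdot> (X m \<otimes> minor j l)"
  by (simp add: minor_eq normal_order assms q_nonzero less_trans [OF assms(4,5)] one_smul)

lemma minor_q_commutes_Y:
  assumes J: "j \<in> J" "l \<in> J" "m \<in> J" "j < l" "l < m"
  shows "minor j l \<otimes> Y m = q \<cdot> (Y m \<otimes> minor j l)"
proof -
  \<comment> \<open>Moving \<open>Y m\<close> past \<open>X j\<close> and past \<open>X l\<close> produces two correction terms, which cancel.\<close>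
  let ?t = "X m \<otimes> (Y j \<otimes> Y l)"
  have "(q * (inverse q - q)) \<cdot> ?t \<oplus> (- (q * (q * ((inverse q - q) * inverse q)))) \<cdot> ?t = \<zero>"
    using J by (subst add_smul [symmetric]) (simp_all add: q_nonzero zero_smul field_simps)
  then have "(q * (inverse q - q)) \<cdot> ?t \<oplus> (z \<oplus> (- (q * (q * ((inverse q - q) * inverse q)))) \<cdot> ?t) = z"
    if "z \<in> carrier R" for z
    using J that by (simp add: a_lcomm)
  then show ?thesis
    using J by (simp add: minor_eq normal_order q_nonzero less_trans [OF J(4,5)] one_smul a_assoc)
qed

text \<open>
  \<open>minor j l\<close> commutes with the entries of column \<open>j\<close> and commutes up to \<open>q\<close> with those of
  column \<open>m\<close>, and each term of \<open>minor j m\<close> has one factor of each kind.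
\<close>

lemma minor_row:
  assumes J: "j \<in> J" "l \<in> J" "m \<in> J" "j < l" "l < m"
  shows "minor j l \<otimes> minor j m = q \<cdot> (minor j m \<otimes> minor j l)"
proof -
  let ?D = "minor j l"
  have D: "?D \<in> carrier R" using J by simp
  have "?D \<otimes> (X j \<otimes> Y m) = X j \<otimes> (?D \<otimes> Y m)"
    using J D by (simp add: m_assoc [symmetric] minor_commutes_X)
  also have "\<dots> = q \<cdot> (X j \<otimes> Y m \<otimes> ?D)"
    using J D by (simp add: minor_q_commutes_Y mult_smul m_assoc)
  finally have 1: "?D \<otimes> (X j \<otimes> Y m) = q \<cdot> (X j \<otimes> Y m \<otimes> ?D)" .
  have "?D \<otimes> (X m \<otimes> Y j) = q \<cdot> (X m \<otimes> (?D \<otimes> Y j))"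
    using J D by (simp add: m_assoc [symmetric] minor_q_commutes_X smul_mult)
  also have "\<dots> = q \<cdot> (X m \<otimes> Y j \<otimes> ?D)"
    using J D by (simp add: minor_commutes_Y m_assoc)
  finally have 2: "?D \<otimes> (X m \<otimes> Y j) = q \<cdot> (X m \<otimes> Y j \<otimes> ?D)" .
  show ?thesis
    using J D unfolding minor_eq [OF J(1,3)]
    by (simp add: 1 2 r_distr l_distr mult_smul smul_mult smul_add smul_smul mult.commute)
qed

text \<open>
  A relation that a projective module cannot have. Since \<open>q\<close> to the power \<open>Suc N\<close> is \<open>1\<close>, the
  power \<open>minor j l [^] Suc N\<close> moves past \<open>minor j m\<close> and \<open>minor j n\<close>. One of its factors then meets
  \<open>minor m n\<close>, and the Pluecker relation replaces this product by multiples of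
  \<open>minor j m \<otimes> minor l n\<close> and \<open>minor j n \<otimes> minor l m\<close>. In either case the new first factor
  completes the corresponding \<open>N\<close>-th power to a \<open>Suc N\<close>-th power. The scalars \<open>a\<close> and \<open>b\<close> are,
  up to sign, the powers of \<open>q\<close> from the Pluecker relation and the reordering.
\<close>

lemma minor_syzygy:
  assumes J: "j \<in> J" "l \<in> J" "m \<in> J" "n \<in> J" and less: "j < l" "l < m" "m < n"
    and root: "q ^ Suc N = 1"
  shows "\<exists>a b. minor j l [^] Suc N \<otimes> (minor j m [^] N \<otimes> minor j n [^] N \<otimes> minor m n) =
    minor j m [^] Suc N \<otimes> (a \<cdot> (minor j n [^] N \<otimes> minor j l [^] N \<otimes> minor l n)) \<oplus>
    minor j n [^] Suc N \<otimes> (b \<cdot> (minor j m [^] N \<otimes> minor j l [^] N \<otimes> minor l m))"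
proof -
  let ?x = "minor j l" and ?y = "minor j m" and ?w = "minor j n"
  have cl [simp]: "?x \<in> carrier R" "?y \<in> carrier R" "?w \<in> carrier R" "minor m n \<in> carrier R"
      "minor l n \<in> carrier R" "minor l m \<in> carrier R"
    using J by auto
  have xy: "?x \<otimes> ?y = q \<cdot> (?y \<otimes> ?x)" and xw: "?x \<otimes> ?w = q \<cdot> (?w \<otimes> ?x)"
    and yw: "?y \<otimes> ?w = q \<cdot> (?w \<otimes> ?y)"
    using J less by (auto intro!: minor_row)
  have wy: "?w \<otimes> ?y = inverse q \<cdot> (?y \<otimes> ?w)"
    using yw by (intro q_commute_swap) auto
  have xN_yw: "?x [^] Suc N \<otimes> (?y [^] N \<otimes> ?w [^] N) = (?y [^] N \<otimes> ?w [^] N) \<otimes> ?x [^] Suc N"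
  proof -
    have "?x [^] Suc N \<otimes> ?y [^] N = ?y [^] N \<otimes> ?x [^] Suc N"
      "?x [^] Suc N \<otimes> ?w [^] N = ?w [^] N \<otimes> ?x [^] Suc N"
      using q_commute_powers [OF _ _ xy, of "Suc N" N] q_commute_powers [OF _ _ xw, of "Suc N" N]
      by (simp_all only: root power_one cl one_smul nat_pow_closed m_closed)
    then show ?thesis by (metis m_assoc nat_pow_closed cl)
  qed
  obtain a where a: "?w [^] N \<otimes> ?x [^] N \<otimes> ?y = a \<cdot> (?y \<otimes> (?w [^] N \<otimes> ?x [^] N))"
  proof
    have "?w [^] N \<otimes> ?x [^] N \<otimes> ?y = q ^ N \<cdot> (?w [^] N \<otimes> ?y \<otimes> ?x [^] N)"
      using q_commute_power_left [OF _ _ xy, of N] by (simp add: m_assoc mult_smul)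
    also have "\<dots> = q ^ N \<cdot> inverse q ^ N \<cdot> (?y \<otimes> (?w [^] N \<otimes> ?x [^] N))"
      using q_commute_power_left [OF _ _ wy, of N] by (simp add: m_assoc smul_mult)
    finally show "?w [^] N \<otimes> ?x [^] N \<otimes> ?y = (q ^ N * inverse q ^ N) \<cdot> (?y \<otimes> (?w [^] N \<otimes> ?x [^] N))"
      by (simp add: smul_smul)
  qed
  have xNw: "?x [^] N \<otimes> ?w = q ^ N \<cdot> (?w \<otimes> ?x [^] N)"
    using q_commute_power_left [OF _ _ xw, of N] by simp
  have yNw: "?y [^] N \<otimes> ?w [^] Suc N = (q ^ N) ^ Suc N \<cdot> (?w [^] Suc N \<otimes> ?y [^] N)"
    using q_commute_powers [OF _ _ yw, of N "Suc N"] by (simp only: cl)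
  let ?P = "?y [^] N \<otimes> ?w [^] N \<otimes> ?x [^] N"
  have A: "?P \<otimes> (?y \<otimes> minor l n) = ?y [^] Suc N \<otimes> (a \<cdot> (?w [^] N \<otimes> ?x [^] N \<otimes> minor l n))"
  proof -
    have "?P \<otimes> (?y \<otimes> minor l n) = ?y [^] N \<otimes> (?w [^] N \<otimes> ?x [^] N \<otimes> ?y) \<otimes> minor l n"
      by (simp add: m_assoc)
    also have "\<dots> = ?y [^] Suc N \<otimes> (a \<cdot> (?w [^] N \<otimes> ?x [^] N \<otimes> minor l n))"
      unfolding a by (simp add: m_assoc smul_mult mult_smul)
    finally show ?thesis .
  qed
  have B: "?P \<otimes> (?w \<otimes> minor l m)
    = ?w [^] Suc N \<otimes> ((q ^ N * (q ^ N) ^ Suc N) \<cdot> (?y [^] N \<otimes> ?x [^] N \<otimes> minor l m))"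
  proof -
    have "?P \<otimes> (?w \<otimes> minor l m) = ?y [^] N \<otimes> ?w [^] N \<otimes> (?x [^] N \<otimes> ?w) \<otimes> minor l m"
      by (simp add: m_assoc)
    also have "\<dots> = q ^ N \<cdot> ((?y [^] N \<otimes> ?w [^] Suc N) \<otimes> ?x [^] N \<otimes> minor l m)"
      unfolding xNw by (simp add: m_assoc smul_mult mult_smul)
    also have "\<dots> = ?w [^] Suc N \<otimes> ((q ^ N * (q ^ N) ^ Suc N) \<cdot> (?y [^] N \<otimes> ?x [^] N \<otimes> minor l m))"
      unfolding yNw by (simp add: m_assoc smul_mult mult_smul smul_smul del: nat_pow_Suc power_Suc)
    finally show ?thesis .
  qed
  have "?x [^] Suc N \<otimes> (?y [^] N \<otimes> ?w [^] N \<otimes> minor m n)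
    = ?y [^] N \<otimes> ?w [^] N \<otimes> ?x [^] Suc N \<otimes> minor m n"
    using xN_yw by (metis m_assoc nat_pow_closed m_closed cl)
  also have "\<dots> = ?P \<otimes> (?x \<otimes> minor m n)"
    by (simp add: m_assoc)
  also have "\<dots> = q \<cdot> (?P \<otimes> (?y \<otimes> minor l n)) \<oplus> (- (q ^ 2)) \<cdot> (?P \<otimes> (?w \<otimes> minor l m))"
    by (simp add: Pluecker [OF J less] r_distr mult_smul)
  also have "\<dots> = ?y [^] Suc N \<otimes> ((q * a) \<cdot> (?w [^] N \<otimes> ?x [^] N \<otimes> minor l n)) \<oplus>
    ?w [^] Suc N \<otimes> ((- (q ^ 2) * (q ^ N * (q ^ N) ^ Suc N)) \<cdot> (?y [^] N \<otimes> ?x [^] N \<otimes> minor l m))"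
    unfolding A B by (simp add: mult_smul smul_smul del: nat_pow_Suc power_Suc)
  finally show ?thesis by blast
qed

end

section \<open>The quantum matrix algebra as a ring with central scalars\<close>

lemma qmat_free_simps:
  "\<zero>\<^bsub>qmat_free\<^esub> = (\<lambda>w. 0)" "f \<oplus>\<^bsub>qmat_free\<^esub> g = (\<lambda>w. f w + g w)"
  "f \<otimes>\<^bsub>qmat_free\<^esub> g = (\<lambda>w. \<Sum>i\<le>length w. f (take i w) * g (drop i w))"
  by (simp_all add: qmat_free_def free_algebra_def)

lemma qmat_free_carrier_finite: "f \<in> carrier qmat_free \<Longrightarrow> finite {w. f w \<noteq> 0}"
  by (simp add: qmat_free_def free_algebra_def)

lemma monomial_Nil_closed: "monomial a [] \<in> carrier qmat_free"
  by (simp add: qmat_free_def monomial_closed)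

lemma monomial_gen_closed:
  "1 \<le> i \<Longrightarrow> i \<le> 2 \<Longrightarrow> 1 \<le> j \<Longrightarrow> j \<le> 4 \<Longrightarrow> monomial 1 [(i, j)] \<in> carrier qmat_free"
  by (simp add: qmat_free_def monomial_closed)

lemma qmat_free_minus:
  assumes "f \<in> carrier qmat_free" "g \<in> carrier (qmat_free :: ((nat \<times> nat) list \<Rightarrow> 'k::field) ring)"
  shows "f \<ominus>\<^bsub>qmat_free\<^esub> g = (\<lambda>w. f w - g w)"
proof -
  interpret F: ring "qmat_free :: ((nat \<times> nat) list \<Rightarrow> 'k) ring" by (rule ring_qmat_free)
  have "(f \<ominus>\<^bsub>qmat_free\<^esub> g) \<oplus>\<^bsub>qmat_free\<^esub> g = f"
    using assms by (simp add: a_minus_def F.a_assoc F.l_neg)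
  then have "(f \<ominus>\<^bsub>qmat_free\<^esub> g) w + g w = f w" for w
    unfolding qmat_free_simps by (rule fun_cong)
  then show ?thesis by (auto simp: eq_diff_eq)
qed

lemma qmat_free_scalar_mult:
  "monomial a [] \<otimes>\<^bsub>qmat_free\<^esub> f = (\<lambda>w. a * f w)"
proof
  fix w :: "(nat \<times> nat) list"
  have "(monomial a [] \<otimes>\<^bsub>qmat_free\<^esub> f) w = (\<Sum>i\<le>length w. if i = 0 then a * f w else 0)"
    unfolding qmat_free_simps by (intro sum.cong) (auto simp: monomial_def)
  then show "(monomial a [] \<otimes>\<^bsub>qmat_free\<^esub> f) w = a * f w" by simp
qed

lemma qmat_free_mult_scalar:
  "f \<otimes>\<^bsub>qmat_free\<^esub> monomial a [] = (\<lambda>w. f w * a)"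
proof
  fix w :: "(nat \<times> nat) list"
  have "(f \<otimes>\<^bsub>qmat_free\<^esub> monomial a []) w = (\<Sum>i\<le>length w. if i = length w then f w * a else 0)"
    unfolding qmat_free_simps by (intro sum.cong) (auto simp: monomial_def)
  then show "(f \<otimes>\<^bsub>qmat_free\<^esub> monomial a []) w = f w * a" by simp
qed

lemma qmat_coset_hom: "(+>\<^bsub>qmat_free\<^esub>) (qmat_ideal q) \<in> ring_hom qmat_free (qmat q)"
  unfolding qmat_def by (rule ideal.rcos_ring_hom [OF ideal_qmat_ideal])

lemma qmat_coset_mult:
  "f \<in> carrier qmat_free \<Longrightarrow> g \<in> carrier qmat_free \<Longrightarrow>
    (qmat_ideal q +>\<^bsub>qmat_free\<^esub> f) \<otimes>\<^bsub>qmat q\<^esub> (qmat_ideal q +>\<^bsub>qmat_free\<^esub> g)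
      = qmat_ideal q +>\<^bsub>qmat_free\<^esub> (f \<otimes>\<^bsub>qmat_free\<^esub> g)"
  by (rule ring_hom_mult [OF qmat_coset_hom, symmetric])

lemma qmat_coset_add:
  "f \<in> carrier qmat_free \<Longrightarrow> g \<in> carrier qmat_free \<Longrightarrow>
    (qmat_ideal q +>\<^bsub>qmat_free\<^esub> f) \<oplus>\<^bsub>qmat q\<^esub> (qmat_ideal q +>\<^bsub>qmat_free\<^esub> g)
      = qmat_ideal q +>\<^bsub>qmat_free\<^esub> (f \<oplus>\<^bsub>qmat_free\<^esub> g)"
  by (rule ring_hom_add [OF qmat_coset_hom, symmetric])

lemma qmat_carrierE:
  assumes "A \<in> carrier (qmat q)"
  obtains f where "f \<in> carrier qmat_free" "A = qmat_ideal q +>\<^bsub>qmat_free\<^esub> f"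
  using assms unfolding qmat_def FactRing_def A_RCOSETS_def' by auto

lemma qmat_relation_eq:
  assumes "f \<ominus>\<^bsub>qmat_free\<^esub> g \<in> qmat_relations q" "f \<in> carrier qmat_free" "g \<in> carrier qmat_free"
  shows "qmat_ideal q +>\<^bsub>qmat_free\<^esub> f = qmat_ideal q +>\<^bsub>qmat_free\<^esub> g"
proof -
  have "f \<ominus>\<^bsub>qmat_free\<^esub> g \<in> qmat_ideal q"
    unfolding qmat_ideal_def
    using ring.genideal_self [OF ring_qmat_free qmat_relations_closed] assms(1) by blast
  then show ?thesis
    using ring.quotient_eq_iff_same_a_r_cos [OF ring_qmat_free ideal_qmat_ideal assms(2,3)] by blast
qed

lemma central_scalars_qmat: "central_scalars (qmat q) (qmat_scalar q)"
proof (intro central_scalars.intro central_scalars_axioms.intro ring_qmat qmat_scalar_closed)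
  fix a b
  show "qmat_scalar q (a + b) = qmat_scalar q a \<oplus>\<^bsub>qmat q\<^esub> qmat_scalar q b"
    unfolding qmat_scalar_def
    by (simp add: qmat_coset_add monomial_Nil_closed) (simp add: qmat_free_simps monomial_def if_distrib cong: if_cong)
  show "qmat_scalar q (a * b) = qmat_scalar q a \<otimes>\<^bsub>qmat q\<^esub> qmat_scalar q b"
    unfolding qmat_scalar_def
    by (simp add: qmat_coset_mult monomial_Nil_closed qmat_free_scalar_mult)
      (simp add: monomial_def if_distrib cong: if_cong)
  show "qmat_scalar q 1 = \<one>\<^bsub>qmat q\<^esub>"
  proof -
    have "monomial 1 [] = (\<one>\<^bsub>qmat_free\<^esub> :: (nat \<times> nat) list \<Rightarrow> 'a)"
      by (simp add: qmat_free_def free_algebra_def monomial_def)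
    then show ?thesis unfolding qmat_scalar_def using ring_hom_one [OF qmat_coset_hom] by metis
  qed
next
  fix x a assume "x \<in> carrier (qmat q)"
  then obtain f where "f \<in> carrier qmat_free" "x = qmat_ideal q +>\<^bsub>qmat_free\<^esub> f"
    by (rule qmat_carrierE)
  then show "x \<otimes>\<^bsub>qmat q\<^esub> qmat_scalar q a = qmat_scalar q a \<otimes>\<^bsub>qmat q\<^esub> x"
    unfolding qmat_scalar_def
    by (simp add: qmat_coset_mult monomial_Nil_closed qmat_free_scalar_mult qmat_free_mult_scalar mult.commute)
qed

lemma quantum_two_rows_qmat:
  assumes "q \<noteq> 0"
  shows "quantum_two_rows (qmat q) (qmat_scalar q) q {1..4} (qmat_gen q 1) (qmat_gen q 2)"
proof -
  interpret F: ring "qmat_free :: ((nat \<times> nat) list \<Rightarrow> 'a) ring" by (rule ring_qmat_free)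
  interpret central_scalars "qmat q" "qmat_scalar q" by (rule central_scalars_qmat)
  note closed = monomial_Nil_closed monomial_gen_closed F.m_closed F.minus_closed
  have row: "qmat_gen q i j \<otimes>\<^bsub>qmat q\<^esub> qmat_gen q i l = smul q (qmat_gen q i l \<otimes>\<^bsub>qmat q\<^esub> qmat_gen q i j)"
    if "1 \<le> i" "i \<le> 2" "1 \<le> j" "j < l" "l \<le> 4" for i j l
  proof -
    have "monomial 1 [(i, j)] \<otimes>\<^bsub>qmat_free\<^esub> monomial 1 [(i, l)] \<ominus>\<^bsub>qmat_free\<^esub>
      monomial q [] \<otimes>\<^bsub>qmat_free\<^esub> monomial 1 [(i, l)] \<otimes>\<^bsub>qmat_free\<^esub> monomial 1 [(i, j)] \<in> qmat_relations q"
      unfolding qmat_relations_def Let_def using that by blast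
    from qmat_relation_eq [OF this] show ?thesis
      using that by (simp add: smul_def qmat_gen_def qmat_scalar_def qmat_coset_mult closed F.m_assoc)
  qed
  have col: "qmat_gen q 1 j \<otimes>\<^bsub>qmat q\<^esub> qmat_gen q 2 j = smul q (qmat_gen q 2 j \<otimes>\<^bsub>qmat q\<^esub> qmat_gen q 1 j)"
    if "1 \<le> j" "j \<le> 4" for j
  proof -
    have "monomial 1 [(1, j)] \<otimes>\<^bsub>qmat_free\<^esub> monomial 1 [(2, j)] \<ominus>\<^bsub>qmat_free\<^esub>
      monomial q [] \<otimes>\<^bsub>qmat_free\<^esub> monomial 1 [(2, j)] \<otimes>\<^bsub>qmat_free\<^esub> monomial 1 [(1, j)] \<in> qmat_relations q"
      unfolding qmat_relations_def Let_def using that by blast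
    from qmat_relation_eq [OF this] show ?thesis
      using that by (simp add: smul_def qmat_gen_def qmat_scalar_def qmat_coset_mult closed F.m_assoc)
  qed
  have anti: "qmat_gen q 1 l \<otimes>\<^bsub>qmat q\<^esub> qmat_gen q 2 j = qmat_gen q 2 j \<otimes>\<^bsub>qmat q\<^esub> qmat_gen q 1 l"
    if "1 \<le> j" "j < l" "l \<le> 4" for j l
  proof -
    have "monomial 1 [(1, l)] \<otimes>\<^bsub>qmat_free\<^esub> monomial 1 [(2, j)] \<ominus>\<^bsub>qmat_free\<^esub>
      monomial 1 [(2, j)] \<otimes>\<^bsub>qmat_free\<^esub> monomial 1 [(1, l)] \<in> qmat_relations q"
      unfolding qmat_relations_def Let_def using that by blast
    from qmat_relation_eq [OF this] show ?thesis
      using that by (simp add: qmat_gen_def qmat_coset_mult closed)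
  qed
  have diag: "qmat_gen q 1 j \<otimes>\<^bsub>qmat q\<^esub> qmat_gen q 2 l = qmat_gen q 2 l \<otimes>\<^bsub>qmat q\<^esub> qmat_gen q 1 j \<oplus>\<^bsub>qmat q\<^esub>
      smul (q - inverse q) (qmat_gen q 1 l \<otimes>\<^bsub>qmat q\<^esub> qmat_gen q 2 j)"
    if "1 \<le> j" "j < l" "l \<le> 4" for j l
  proof -
    let ?f = "monomial 1 [(1, j)] \<otimes>\<^bsub>qmat_free\<^esub> monomial (1::'a) [(2, l)]"
    let ?g = "monomial 1 [(2, l)] \<otimes>\<^bsub>qmat_free\<^esub> monomial (1::'a) [(1, j)]"
    let ?h = "monomial (q - inverse q) [] \<otimes>\<^bsub>qmat_free\<^esub> monomial 1 [(1, l)] \<otimes>\<^bsub>qmat_free\<^esub> monomial 1 [(2, j)]"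
    have cl: "?f \<in> carrier qmat_free" "?g \<in> carrier qmat_free" "?h \<in> carrier qmat_free"
      using that by (simp_all add: closed)
    have "(?f \<ominus>\<^bsub>qmat_free\<^esub> ?g) \<ominus>\<^bsub>qmat_free\<^esub> ?h \<in> qmat_relations q"
      unfolding qmat_relations_def Let_def using that by blast
    also have "(?f \<ominus>\<^bsub>qmat_free\<^esub> ?g) \<ominus>\<^bsub>qmat_free\<^esub> ?h = ?f \<ominus>\<^bsub>qmat_free\<^esub> (?g \<oplus>\<^bsub>qmat_free\<^esub> ?h)"
      using cl by (simp add: a_minus_def F.minus_add F.a_assoc)
    finally have "qmat_ideal q +>\<^bsub>qmat_free\<^esub> ?f = qmat_ideal q +>\<^bsub>qmat_free\<^esub> (?g \<oplus>\<^bsub>qmat_free\<^esub> ?h)"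
      using cl by (intro qmat_relation_eq) auto
    then show ?thesis
      using that
      by (simp add: smul_def qmat_gen_def qmat_scalar_def qmat_coset_mult qmat_coset_add closed F.m_assoc F.a_closed)
  qed
  show ?thesis
    by unfold_locales (simp_all add: assms qmat_gen_closed row col anti diag del: One_nat_def)
qed

lemma minor_eq_qminor:
  assumes "q \<noteq> 0" "1 \<le> j" "j \<le> 4" "1 \<le> l" "l \<le> 4"
  shows "quantum_two_rows.minor (qmat q) (qmat_scalar q) q (qmat_gen q 1) (qmat_gen q 2) j l = qminor q j l"
proof -
  interpret quantum_two_rows "qmat q" "qmat_scalar q" q "{1..4}" "qmat_gen q 1" "qmat_gen q 2"
    by (rule quantum_two_rows_qmat [OF assms(1)])
  show ?thesis
    using assms by (simp add: minor_def qminor_def smul_def m_assoc qmat_gen_closed del: One_nat_def)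
qed

section \<open>Representations of quantum matrices on spaces of functions\<close>

text \<open>
  The action of the free algebra in which the letter \<open>x\<close> acts by the operator \<open>T x\<close>, and a word by
  the composition of the operators of its letters.
\<close>

definition word_act :: "('x \<Rightarrow> ('a \<Rightarrow> 'k) \<Rightarrow> 'a \<Rightarrow> 'k) \<Rightarrow> ('x list \<Rightarrow> 'k::field) \<Rightarrow> ('a \<Rightarrow> 'k) \<Rightarrow> 'a \<Rightarrow> 'k" where
  "word_act T f v m = (\<Sum>w | f w \<noteq> 0. f w * foldr T w v m)"

lemma word_act_eq:
  "finite U \<Longrightarrow> {w. f w \<noteq> 0} \<subseteq> U \<Longrightarrow> word_act T f v m = (\<Sum>w\<in>U. f w * foldr T w v m)"
  unfolding word_act_def by (rule sum.mono_neutral_left) auto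

lemma word_act_monomial: "word_act T (monomial a w) v m = a * foldr T w v m"
  by (subst word_act_eq [of "{w}"]) (auto simp: monomial_def)

lemma word_act_add:
  assumes "f \<in> carrier qmat_free" "g \<in> carrier qmat_free"
  shows "word_act T (f \<oplus>\<^bsub>qmat_free\<^esub> g) v m = word_act T f v m + word_act T g v m"
proof -
  let ?U = "{w. f w \<noteq> 0} \<union> {w. g w \<noteq> 0}"
  have "finite ?U" using assms by (simp add: qmat_free_carrier_finite)
  note eq = word_act_eq [OF this, of _ T v m]
  have "word_act T (\<lambda>w. f w + g w) v m = (\<Sum>w\<in>?U. (f w + g w) * foldr T w v m)"
    by (rule eq) auto
  moreover have "word_act T f v m = (\<Sum>w\<in>?U. f w * foldr T w v m)"
    "word_act T g v m = (\<Sum>w\<in>?U. g w * foldr T w v m)"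
    by (auto intro!: eq)
  ultimately show ?thesis
    by (simp add: qmat_free_simps distrib_right sum.distrib)
qed

lemma word_act_diff:
  assumes "f \<in> carrier qmat_free" "g \<in> carrier qmat_free"
  shows "word_act T (f \<ominus>\<^bsub>qmat_free\<^esub> g) v m = word_act T f v m - word_act T g v m"
proof -
  let ?U = "{w. f w \<noteq> 0} \<union> {w. g w \<noteq> 0}"
  have "finite ?U" using assms by (simp add: qmat_free_carrier_finite)
  note eq = word_act_eq [OF this, of _ T v m]
  have "word_act T (\<lambda>w. f w - g w) v m = (\<Sum>w\<in>?U. (f w - g w) * foldr T w v m)"
    by (rule eq) auto
  moreover have "word_act T f v m = (\<Sum>w\<in>?U. f w * foldr T w v m)"
    "word_act T g v m = (\<Sum>w\<in>?U. g w * foldr T w v m)"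
    by (auto intro!: eq)
  ultimately show ?thesis
    by (simp add: qmat_free_minus [OF assms] left_diff_distrib sum_subtractf)
qed

locale linear_operators =
  fixes T :: "'x \<Rightarrow> ('a \<Rightarrow> 'k::field) \<Rightarrow> 'a \<Rightarrow> 'k"
  assumes T_add: "T x (\<lambda>m. u m + v m) = (\<lambda>m. T x u m + T x v m)"
    and T_scale: "T x (\<lambda>m. c * v m) = (\<lambda>m. c * T x v m)"
begin

lemma T_zero: "T x (\<lambda>m. 0) = (\<lambda>m. 0)"
  using T_scale [of x 0] by simp

lemma foldr_sum:
  "finite U \<Longrightarrow> foldr T w (\<lambda>m. \<Sum>u\<in>U. c u * g u m) = (\<lambda>m. \<Sum>u\<in>U. c u * foldr T w (g u) m)"
proof (induction U rule: finite_induct)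
  case empty
  show ?case by (induction w) (simp_all add: T_zero)
next
  case (insert a U)
  have "foldr T w (\<lambda>m. c a * g a m + h m) = (\<lambda>m. c a * foldr T w (g a) m + foldr T w h m)" for h
    by (induction w) (simp_all add: T_add T_scale)
  with insert show ?case by simp
qed

end

text \<open>
  A pair of words \<open>u\<close> from the support of \<open>f\<close> and \<open>w\<close> from that of \<open>g\<close> is the same as the word
  \<open>u @ w\<close> with the position at which to split it, so both sides are one sum over pairs.
\<close>

lemma word_act_mult:
  fixes f g :: "(nat \<times> nat) list \<Rightarrow> 'k::field"
  assumes "linear_operators T" and f: "f \<in> carrier qmat_free" and g: "g \<in> carrier qmat_free"
  shows "word_act T (f \<otimes>\<^bsub>qmat_free\<^esub> g) v m = word_act T f (word_act T g v) m"
proof -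
  interpret linear_operators T by fact
  let ?F = "{w. f w \<noteq> 0}" and ?G = "{w. g w \<noteq> 0}"
  let ?W = "(\<lambda>(u, w). u @ w) ` (?F \<times> ?G)"
  let ?t = "\<lambda>(u, w). f u * g w * foldr T (u @ w) v m"
  let ?S = "SIGMA w:?W. {..length w}"
  have fin: "finite ?F" "finite ?G" using f g by (simp_all add: qmat_free_carrier_finite)
  have supp: "{w. (f \<otimes>\<^bsub>qmat_free\<^esub> g) w \<noteq> 0} \<subseteq> ?W"
  proof
    fix w assume "w \<in> {w. (f \<otimes>\<^bsub>qmat_free\<^esub> g) w \<noteq> 0}"
    then obtain i where "f (take i w) * g (drop i w) \<noteq> 0"
      unfolding qmat_free_simps by (auto elim: sum.not_neutral_contains_not_neutral)
    then show "w \<in> ?W" by (intro image_eqI [of _ _ "(take i w, drop i w)"]) auto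
  qed
  have "word_act T (f \<otimes>\<^bsub>qmat_free\<^esub> g) v m = (\<Sum>w\<in>?W. \<Sum>i\<le>length w. ?t (take i w, drop i w))"
    by (subst word_act_eq [OF _ supp]) (simp_all add: fin qmat_free_simps sum_distrib_right del: foldr_append)
  also have "\<dots> = (\<Sum>(w, i)\<in>?S. ?t (take i w, drop i w))"
    by (subst sum.Sigma) (auto simp: fin)
  also have "\<dots> = (\<Sum>p\<in>?F \<times> ?G. ?t p)"
  proof -
    let ?split = "\<lambda>(u, w). (u @ w, length u)"
    have "(\<Sum>(w, i)\<in>?S. ?t (take i w, drop i w)) = (\<Sum>(w, i)\<in>?split ` (?F \<times> ?G). ?t (take i w, drop i w))"
    proof (rule sum.mono_neutral_right)
      show "\<forall>p\<in>?S - ?split ` (?F \<times> ?G). (case p of (w, i) \<Rightarrow> ?t (take i w, drop i w)) = 0"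
      proof
        fix p assume p: "p \<in> ?S - ?split ` (?F \<times> ?G)"
        obtain w i where wi: "p = (w, i)" by (cases p)
        have "(w, i) = ?split (take i w, drop i w)" using p wi by simp
        then have "(take i w, drop i w) \<notin> ?F \<times> ?G" using p wi by blast
        then show "(case p of (w, i) \<Rightarrow> ?t (take i w, drop i w)) = 0" unfolding wi by auto
      qed
    qed (auto simp: fin)
    also have "\<dots> = (\<Sum>p\<in>?F \<times> ?G. ?t p)"
      by (subst sum.reindex) (auto simp: inj_on_def case_prod_beta)
    finally show ?thesis .
  qed
  also have "\<dots> = (\<Sum>u\<in>?F. \<Sum>w\<in>?G. ?t (u, w))"
    by (simp add: sum.cartesian_product)
  also have "\<dots> = (\<Sum>u\<in>?F. f u * foldr T u (\<lambda>m. \<Sum>w\<in>?G. g w * foldr T w v m) m)"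
    by (simp add: foldr_sum fin sum_distrib_left mult.assoc)
  also have "\<dots> = word_act T f (word_act T g v) m"
    by (simp add: word_act_def [abs_def])
  finally show ?thesis .
qed

locale qmat_representation = linear_operators T
  for q :: "'k::field" and T :: "nat \<times> nat \<Rightarrow> ('a \<Rightarrow> 'k) \<Rightarrow> 'a \<Rightarrow> 'k" +
  assumes T_row: "\<lbrakk>1 \<le> i; i \<le> 2; 1 \<le> j; j < l; l \<le> 4\<rbrakk>
      \<Longrightarrow> T (i, j) (T (i, l) v) m = q * T (i, l) (T (i, j) v) m"
    and T_col: "\<lbrakk>1 \<le> j; j \<le> 4\<rbrakk> \<Longrightarrow> T (1, j) (T (2, j) v) m = q * T (2, j) (T (1, j) v) m"
    and T_anti: "\<lbrakk>1 \<le> j; j < l; l \<le> 4\<rbrakk> \<Longrightarrow> T (1, l) (T (2, j) v) m = T (2, j) (T (1, l) v) m"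
    and T_diag: "\<lbrakk>1 \<le> j; j < l; l \<le> 4\<rbrakk> \<Longrightarrow> T (1, j) (T (2, l) v) m =
      T (2, l) (T (1, j) v) m + (q - inverse q) * T (1, l) (T (2, j) v) m"
begin

lemmas word_act_mult' = word_act_mult [OF linear_operators_axioms]

lemma word_act_zero: "f \<in> carrier qmat_free \<Longrightarrow> word_act T f (\<lambda>m. 0) m = 0"
  using foldr_sum [of "{}"] by (simp add: word_act_def)

lemma word_act_relation:
  assumes "r \<in> qmat_relations q"
  shows "word_act T r v m = 0"
proof -
  interpret F: ring "qmat_free :: ((nat \<times> nat) list \<Rightarrow> 'k) ring" by (rule ring_qmat_free)
  note closed = monomial_Nil_closed monomial_gen_closed F.m_closed F.minus_closed
  note act = word_act_diff word_act_mult' word_act_monomial closed foldr_Cons foldr_Nil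
  have [simp]: "word_act T (monomial 1 [x]) = T x" for x
    by (auto simp: word_act_monomial fun_eq_iff)
  show ?thesis
    using assms unfolding qmat_relations_def Let_def
    by (elim UnE CollectE exE conjE)
      (simp_all add: act T_row T_col T_anti T_diag del: One_nat_def)
qed

lemma word_act_ideal:
  assumes "f \<in> qmat_ideal q"
  shows "word_act T f v m = 0"
proof -
  interpret F: ring "qmat_free :: ((nat \<times> nat) list \<Rightarrow> 'k) ring" by (rule ring_qmat_free)
  let ?K = "{f \<in> carrier qmat_free. \<forall>v m. word_act T f v m = 0}"
  have "ideal ?K qmat_free"
  proof (rule idealI [OF ring_qmat_free])
    show "subgroup ?K (add_monoid qmat_free)"
    proof (rule F.add.subgroupI)
      have zero: "word_act T \<zero>\<^bsub>qmat_free\<^esub> v m = 0" for v m by (simp add: word_act_def qmat_free_simps(1))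
      then have "\<zero>\<^bsub>qmat_free\<^esub> \<in> ?K" by simp
      then show "?K \<noteq> {}" by blast
      show "\<ominus>\<^bsub>qmat_free\<^esub> f \<in> ?K" if f: "f \<in> ?K" for f
      proof -
        have "word_act T (\<zero>\<^bsub>qmat_free\<^esub> \<ominus>\<^bsub>qmat_free\<^esub> f) v m = 0" for v m
          using f zero by (subst word_act_diff [OF F.zero_closed]) auto
        then show ?thesis using f by (simp add: a_minus_def)
      qed
    qed (auto simp: word_act_add)
  next
    fix a x :: "(nat \<times> nat) list \<Rightarrow> 'k"
    assume a: "a \<in> ?K" and x: "x \<in> carrier qmat_free"
    have "word_act T a v = (\<lambda>m. 0)" for v using a by auto
    then show "x \<otimes>\<^bsub>qmat_free\<^esub> a \<in> ?K" using a x by (simp add: word_act_mult' word_act_zero)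
    show "a \<otimes>\<^bsub>qmat_free\<^esub> x \<in> ?K" using a x by (simp add: word_act_mult')
  qed
  moreover have "qmat_relations q \<subseteq> ?K"
    using qmat_relations_closed word_act_relation by blast
  ultimately have "qmat_ideal q \<subseteq> ?K"
    unfolding qmat_ideal_def by (rule F.genideal_minimal)
  then show ?thesis using assms by blast
qed

text \<open>
  All representatives of a coset act in the same way because the defining ideal acts as zero, so
  any choice of representative gives the action of the quotient.
\<close>

definition act :: "((nat \<times> nat) list \<Rightarrow> 'k) set \<Rightarrow> ('a \<Rightarrow> 'k) \<Rightarrow> 'a \<Rightarrow> 'k" where
  "act A = word_act T (SOME f. f \<in> A)"

lemma act_coset:
  assumes f: "f \<in> carrier qmat_free"
  shows "act (qmat_ideal q +>\<^bsub>qmat_free\<^esub> f) = word_act T f"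
proof (intro ext)
  fix v m
  interpret F: ring "qmat_free :: ((nat \<times> nat) list \<Rightarrow> 'k) ring" by (rule ring_qmat_free)
  interpret I: ideal "qmat_ideal q" "qmat_free" by (rule ideal_qmat_ideal)
  let ?g = "SOME g. g \<in> qmat_ideal q +>\<^bsub>qmat_free\<^esub> f"
  have "f \<in> qmat_ideal q +>\<^bsub>qmat_free\<^esub> f" using f by (rule I.a_rcos_self)
  then have "?g \<in> qmat_ideal q +>\<^bsub>qmat_free\<^esub> f" by (rule someI [where P = "\<lambda>g. g \<in> qmat_ideal q +>\<^bsub>qmat_free\<^esub> f"])
  then obtain h where h: "h \<in> qmat_ideal q" "?g = h \<oplus>\<^bsub>qmat_free\<^esub> f"
    unfolding a_r_coset_def' by blast
  have "word_act T ?g v m = word_act T f v m"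
    using h f by (simp add: word_act_add I.Icarr word_act_ideal)
  then show "act (qmat_ideal q +>\<^bsub>qmat_free\<^esub> f) v m = word_act T f v m"
    by (simp add: act_def)
qed

lemma act_add:
  assumes "A \<in> carrier (qmat q)" "B \<in> carrier (qmat q)"
  shows "act (A \<oplus>\<^bsub>qmat q\<^esub> B) v m = act A v m + act B v m"
proof -
  interpret F: ring "qmat_free :: ((nat \<times> nat) list \<Rightarrow> 'k) ring" by (rule ring_qmat_free)
  from assms show ?thesis
    by (elim qmat_carrierE) (simp add: qmat_coset_add act_coset word_act_add)
qed

lemma act_mult:
  assumes "A \<in> carrier (qmat q)" "B \<in> carrier (qmat q)"
  shows "act (A \<otimes>\<^bsub>qmat q\<^esub> B) v = act A (act B v)"
proof -
  interpret F: ring "qmat_free :: ((nat \<times> nat) list \<Rightarrow> 'k) ring" by (rule ring_qmat_free)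
  from assms show ?thesis
    by (elim qmat_carrierE) (simp add: fun_eq_iff qmat_coset_mult act_coset word_act_mult')
qed

lemma act_scalar: "act (qmat_scalar q a) v m = a * v m"
  by (simp add: qmat_scalar_def act_coset monomial_Nil_closed word_act_monomial)

lemma act_gen:
  "\<lbrakk>1 \<le> i; i \<le> 2; 1 \<le> j; j \<le> 4\<rbrakk> \<Longrightarrow> act (qmat_gen q i j) v = T (i, j) v"
  by (simp add: fun_eq_iff qmat_gen_def act_coset monomial_gen_closed word_act_monomial)

lemma act_one: "act \<one>\<^bsub>qmat q\<^esub> v = v"
proof -
  interpret central_scalars "qmat q" "qmat_scalar q" by (rule central_scalars_qmat)
  show ?thesis unfolding s_one [symmetric] by (simp add: fun_eq_iff act_scalar)
qed

lemma act_zero: "act \<zero>\<^bsub>qmat q\<^esub> v m = 0"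
proof -
  interpret central_scalars "qmat q" "qmat_scalar q" by (rule central_scalars_qmat)
  show ?thesis unfolding s_zero [symmetric] by (simp add: act_scalar)
qed

lemma act_minus:
  assumes A: "A \<in> carrier (qmat q)"
  shows "act (\<ominus>\<^bsub>qmat q\<^esub> A) v m = - act A v m"
proof -
  interpret M: ring "qmat q" by (rule ring_qmat)
  have "act (A \<oplus>\<^bsub>qmat q\<^esub> (\<ominus>\<^bsub>qmat q\<^esub> A)) v m = 0" using A by (simp add: M.r_neg act_zero)
  then show ?thesis using A by (simp add: act_add eq_neg_iff_add_eq_0 add.commute)
qed

lemma act_power: "A \<in> carrier (qmat q) \<Longrightarrow> act (A [^]\<^bsub>qmat q\<^esub> (n::nat)) = act A ^^ n"
proof (induction n)
  case 0
  then show ?case by (simp add: fun_eq_iff act_one)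
next
  case (Suc n)
  interpret M: ring "qmat q" by (rule ring_qmat)
  from Suc show ?case by (simp add: fun_eq_iff act_mult funpow_swap1)
qed

lemma act_qminor:
  assumes "1 \<le> j" "j < l" "l \<le> 4"
  shows "act (qminor q j l) v m = T (1, j) (T (2, l) v) m - q * T (1, l) (T (2, j) v) m"
proof -
  interpret M: ring "qmat q" by (rule ring_qmat)
  show ?thesis
    unfolding qminor_def a_minus_def
    using assms by (simp add: act_add act_minus act_mult act_scalar act_gen qmat_scalar_closed qmat_gen_closed del: One_nat_def)
qed

end

section \<open>Two representations of the quantum Grassmannian\<close>

text \<open>
  In both representations a function is read as the family of coefficients of a power series or
  of a Laurent series, on which a generator acts by multiplication with a monomial, possibly
  combined with a rescaling of the coefficients, or by zero.

  The first one is evaluation of the matrix \<open>X\<close> at the diagonal matrix with entries \<open>t\<close> and \<open>1\<close>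
  in the first two columns. It sends \<open>[12]\<close> to \<open>t\<close> and the other minors to \<open>0\<close>.
\<close>

definition line_rep :: "nat \<times> nat \<Rightarrow> (nat \<Rightarrow> 'k::field) \<Rightarrow> nat \<Rightarrow> 'k" where
  "line_rep x v n =
    (if x = (1, 1) then if n = 0 then 0 else v (n - 1) else if x = (2, 2) then v n else 0)"

text \<open>
  The second one sends the second column as well as \<open>X\<^sub>2\<^sub>1\<close> and \<open>X\<^sub>1\<^sub>4\<close> to \<open>0\<close>. What is left of the
  minors is \<open>[13] = X\<^sub>1\<^sub>1 X\<^sub>2\<^sub>3\<close>, \<open>[14] = X\<^sub>1\<^sub>1 X\<^sub>2\<^sub>4\<close> and \<open>[34] = X\<^sub>1\<^sub>3 X\<^sub>2\<^sub>4\<close>. The exponents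
  \<open>(a, b, c)\<close> count these three minors, and the shifts are chosen accordingly; so \<open>X\<^sub>1\<^sub>3\<close> has to shift
  \<open>b\<close> in the negative direction, which is why the exponents are integers. The powers of \<open>q\<close> make
  the four remaining generators commute as the relations demand.
\<close>

definition torus_rep ::
    "'k::field \<Rightarrow> nat \<times> nat \<Rightarrow> (int \<times> int \<times> int \<Rightarrow> 'k) \<Rightarrow> int \<times> int \<times> int \<Rightarrow> 'k" where
  "torus_rep q x v = (\<lambda>(a, b, c).
    if x = (1, 1) then q powi c * v (a, b, c)
    else if x = (1, 3) then q powi a * v (a, b + 1, c - 1)
    else if x = (2, 3) then v (a - 1, b, c)
    else if x = (2, 4) then q powi (- a) * v (a, b - 1, c)
    else 0)"

lemma qmat_representation_line_rep: "qmat_representation q line_rep"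
  by unfold_locales (auto simp: line_rep_def fun_eq_iff)

lemma powi_minus_one: "(q::'k::field) \<noteq> 0 \<Longrightarrow> q powi (a - 1) = q powi a * inverse q"
  by (simp add: power_int_diff divide_inverse)

lemma qmat_representation_torus_rep:
  assumes "q \<noteq> 0"
  shows "qmat_representation q (torus_rep q)"
proof unfold_locales
  fix x u v
  show "torus_rep q x (\<lambda>m. u m + v m) = (\<lambda>m. torus_rep q x u m + torus_rep q x v m)"
    by (auto simp: torus_rep_def fun_eq_iff distrib_left)
next
  fix x c v
  show "torus_rep q x (\<lambda>m. c * v m) = (\<lambda>m. c * torus_rep q x v m)"
    by (auto simp: torus_rep_def fun_eq_iff)
qed (use assms in \<open>auto simp: torus_rep_def powi_minus_one power_int_minus split: prod.splits\<close>)

lemma funpow_vanishes: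
  fixes F :: "('a \<Rightarrow> 'k::zero) \<Rightarrow> 'a \<Rightarrow> 'k"
  assumes "\<And>v m. F v m = 0" "n > 0"
  shows "(F ^^ n) v m = 0"
  using assms(2) by (cases n) (simp_all add: assms(1))

locale grassmannian_representations =
  fixes q :: "'k::field"
  assumes q_nonzero: "q \<noteq> 0"
begin

sublocale Line: qmat_representation q line_rep
  by (rule qmat_representation_line_rep)

sublocale Torus: qmat_representation q "torus_rep q"
  by (rule qmat_representation_torus_rep [OF q_nonzero])

lemma line_act_minor:
  assumes "1 \<le> j" "j < l" "l \<le> 4"
  shows "Line.act (qminor q j l) v n = (if j = 1 \<and> l = 2 \<and> n > 0 then v (n - 1) else 0)"
  using assms by (auto simp: Line.act_qminor line_rep_def)

lemma line_act_12_power: "(Line.act (qminor q 1 2) ^^ k) v n = (if n < k then 0 else v (n - k))"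
  by (induction k arbitrary: n) (auto simp: line_act_minor)

lemma torus_act_minor:
  assumes "1 \<le> j" "j < l" "l \<le> 4"
  shows "Torus.act (qminor q j l) v (a, b, c) =
    (if j = 1 \<and> l = 3 then q powi c * v (a - 1, b, c)
     else if j = 1 \<and> l = 4 then q powi (c - a) * v (a, b - 1, c)
     else if j = 3 \<and> l = 4 then v (a, b, c - 1) else 0)"
  using assms q_nonzero
  by (auto simp: Torus.act_qminor torus_rep_def power_int_diff power_int_minus divide_inverse)

lemma torus_act_13_power:
  "(Torus.act (qminor q 1 3) ^^ n) v (a, b, c) = (q powi c) ^ n * v (a - int n, b, c)"
  by (induction n arbitrary: a) (auto simp: torus_act_minor algebra_simps)

lemma torus_act_14_power:
  "(Torus.act (qminor q 1 4) ^^ n) v (a, b, c) = (q powi (c - a)) ^ n * v (a, b - int n, c)"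
  by (induction n arbitrary: b) (auto simp: torus_act_minor algebra_simps)

lemma torus_act_34_power:
  "(Torus.act (qminor q 3 4) ^^ n) v (a, b, c) = v (a, b, c - int n)"
  by (induction n arbitrary: c) (auto simp: torus_act_minor algebra_simps)

text \<open>
  The power series among the Laurent series. The generator \<open>X\<^sub>1\<^sub>3\<close> does not preserve them, but the
  minors do: this is where the argument uses that it is about the Grassmannian and not about all
  quantum matrices.
\<close>

definition octant :: "(int \<times> int \<times> int \<Rightarrow> 'k) set" where
  "octant = {v. \<forall>a b c. a < 0 \<or> b < 0 \<or> c < 0 \<longrightarrow> v (a, b, c) = 0}"

lemma octantD: "v \<in> octant \<Longrightarrow> a < 0 \<or> b < 0 \<or> c < 0 \<Longrightarrow> v (a, b, c) = 0"
  by (auto simp: octant_def)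

lemma torus_act_minor_octant:
  assumes "1 \<le> j" "j < l" "l \<le> 4" "v \<in> octant"
  shows "Torus.act (qminor q j l) v \<in> octant"
  using assms(4) by (auto simp: octant_def torus_act_minor [OF assms(1-3)])

lemma grassmannian_closed:
  assumes "A \<in> carrier (qgrassmannian q)"
  shows "A \<in> carrier (qmat q)"
proof -
  have "{qminor q j l |j l. 1 \<le> j \<and> j < l \<and> l \<le> 4} \<subseteq> carrier (qmat q)"
    by (auto intro: qminor_closed)
  from subringE(1) [OF subring_qmat_subalgebra_generated [OF this]] assms show ?thesis
    by (auto simp: qgrassmannian_def)
qed

lemma l_centre_closed: "A \<in> l_centre q n \<Longrightarrow> A \<in> carrier (qgrassmannian q)"
  using subringE(1) [OF subring_l_centre] by blast

text \<open>
  Rule induction for the generated ring, strengthened by the membership of the operands in the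
  ambient ring, on which the rules for the action depend.
\<close>

lemma qmat_subalgebra_generated_induct [consumes 2, case_names scalar gen minus add mult]:
  assumes "A \<in> qmat_subalgebra_generated q H" and "H \<subseteq> carrier (qmat q)"
    and scalar: "\<And>a. P (qmat_scalar q a)" and gen: "\<And>h. h \<in> H \<Longrightarrow> P h"
    and minus: "\<And>A. A \<in> carrier (qmat q) \<Longrightarrow> P A \<Longrightarrow> P (\<ominus>\<^bsub>qmat q\<^esub> A)"
    and add: "\<And>A B. A \<in> carrier (qmat q) \<Longrightarrow> B \<in> carrier (qmat q) \<Longrightarrow> P A \<Longrightarrow> P B \<Longrightarrow> P (A \<oplus>\<^bsub>qmat q\<^esub> B)"
    and mult: "\<And>A B. A \<in> carrier (qmat q) \<Longrightarrow> B \<in> carrier (qmat q) \<Longrightarrow> P A \<Longrightarrow> P B \<Longrightarrow> P (A \<otimes>\<^bsub>qmat q\<^esub> B)"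
  shows "P A"
proof -
  interpret central_scalars "qmat q" "qmat_scalar q" by (rule central_scalars_qmat)
  note closed = subringE(1) [OF subring_qmat_subalgebra_generated [OF assms(2)], THEN subsetD,
      unfolded qmat_subalgebra_generated_def]
  from assms(1) show ?thesis
    unfolding qmat_subalgebra_generated_def
  proof (induction rule: generate_ring.induct)
    case one
    show ?case unfolding s_one [symmetric] by (rule scalar)
  next
    case (incl h)
    then show ?case using scalar gen by auto
  next
    case (a_inv h)
    then show ?case by (intro minus closed)
  next
    case (eng_add h1 h2)
    then show ?case by (intro add closed)
  next
    case (eng_mult h1 h2)
    then show ?case by (intro mult closed)
  qed
qed

lemma torus_act_grassmannian_octant:
  assumes "A \<in> carrier (qgrassmannian q)" "v \<in> octant"
  shows "Torus.act A v \<in> octant"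
proof -
  have "A \<in> qmat_subalgebra_generated q {qminor q j l |j l. 1 \<le> j \<and> j < l \<and> l \<le> 4}"
    using assms(1) by (simp add: qgrassmannian_def)
  moreover have "{qminor q j l |j l. 1 \<le> j \<and> j < l \<and> l \<le> 4} \<subseteq> carrier (qmat q)"
    by (auto intro: qminor_closed)
  ultimately have "\<forall>v\<in>octant. Torus.act A v \<in> octant"
  proof (induction rule: qmat_subalgebra_generated_induct)
    case (gen h)
    then show ?case using torus_act_minor_octant by blast
  qed (auto simp: octant_def Torus.act_scalar Torus.act_minus Torus.act_add Torus.act_mult)
  then show ?thesis using assms(2) by blast
qed

text \<open>The exponents of \<open>[13]\<^sup>n\<^sup>-\<^sup>1 [14]\<^sup>n\<^sup>-\<^sup>1 [34]\<close>.\<close>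

definition target :: "nat \<Rightarrow> int \<times> int \<times> int" where
  "target n = (int n - 1, int n - 1, 1)"

text \<open>
  The number \<open>t\<close> is the constant term of \<open>c\<close> as a polynomial in the \<open>n\<close>-th powers of the minors.
  In degree \<open>0\<close>, respectively at the exponents \<open>target n\<close>, nothing else of \<open>c\<close> is seen: the \<open>n\<close>-th
  power of a minor acts by \<open>0\<close> or, up to scalars, shifts one exponent by \<open>n\<close>, and that exponent is
  at most \<open>n - 1\<close> there. For the exponent \<open>1\<close> of \<open>[34]\<close> this is where \<open>n \<ge> 2\<close> is needed.
\<close>

lemma l_centre_constant_term:
  assumes n: "n \<ge> 2" and "c \<in> l_centre q n"
  shows "\<exists>t. (\<forall>v. Line.act c v 0 = t * v 0) \<and> (\<forall>v\<in>octant. Torus.act c v (target n) = t * v (target n))"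
proof -
  interpret M: ring "qmat q" by (rule ring_qmat)
  let ?P = "\<lambda>c t. (\<forall>v. Line.act c v 0 = t * v 0) \<and>
    (\<forall>v\<in>octant. Torus.act c v \<in> octant \<and> Torus.act c v (target n) = t * v (target n))"
  have "c \<in> qmat_subalgebra_generated q {qminor q j l [^]\<^bsub>qmat q\<^esub> n | j l. 1 \<le> j \<and> j < l \<and> l \<le> 4}"
    using assms(2) by (simp add: l_centre_def)
  moreover have "{qminor q j l [^]\<^bsub>qmat q\<^esub> n | j l. 1 \<le> j \<and> j < l \<and> l \<le> 4} \<subseteq> carrier (qmat q)"
    by (auto intro!: M.nat_pow_closed qminor_closed)
  ultimately have "\<exists>t. ?P c t"
  proof (induction rule: qmat_subalgebra_generated_induct)
    case (scalar a)
    have "?P (qmat_scalar q a) a"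
      by (auto simp: Line.act_scalar Torus.act_scalar octant_def)
    then show ?case ..
  next
    case (gen h)
    then obtain j l where jl: "1 \<le> j" "j < l" "l \<le> 4" and h: "h = qminor q j l [^]\<^bsub>qmat q\<^esub> n"
      by blast
    have act: "Line.act h = Line.act (qminor q j l) ^^ n" "Torus.act h = Torus.act (qminor q j l) ^^ n"
      using jl by (simp_all add: h Line.act_power Torus.act_power qminor_closed)
    have "(Torus.act (qminor q j l) ^^ k) v \<in> octant" if "v \<in> octant" for v k
      using that by (induction k) (simp_all add: torus_act_minor_octant [OF jl])
    moreover have "(Line.act (qminor q j l) ^^ n) v 0 = 0" for v
    proof (cases "(j, l) = (1, 2)")
      case True
      then show ?thesis using n by (simp add: line_act_12_power del: One_nat_def)
    next
      case False
      then show ?thesis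
        using n by (intro funpow_vanishes) (auto simp: line_act_minor [OF jl])
    qed
    moreover have "(Torus.act (qminor q j l) ^^ n) v (target n) = 0" if v: "v \<in> octant" for v
    proof (cases "(j, l) \<in> {(1, 3), (1, 4), (3, 4)}")
      case True
      then show ?thesis using octantD [OF v] n
        by (auto simp: target_def torus_act_13_power torus_act_14_power torus_act_34_power simp del: One_nat_def)
    next
      case False
      then have "Torus.act (qminor q j l) v m = 0" for v m
        by (cases m) (auto simp: torus_act_minor [OF jl])
      then show ?thesis using n by (intro funpow_vanishes) auto
    qed
    ultimately have "?P h 0" unfolding act by simp
    then show ?case ..
  next
    case (minus A)
    then obtain t where "?P A t" by blast
    with minus(1) have "?P (\<ominus>\<^bsub>qmat q\<^esub> A) (- t)"
      by (auto simp: Line.act_minus Torus.act_minus octant_def)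
    then show ?case ..
  next
    case (add A B)
    then obtain t u where "?P A t" "?P B u" by blast
    with add(1,2) have "?P (A \<oplus>\<^bsub>qmat q\<^esub> B) (t + u)"
      by (auto simp: Line.act_add Torus.act_add octant_def distrib_right)
    then show ?case ..
  next
    case (mult A B)
    then obtain t u where "?P A t" "?P B u" by blast
    with mult(1,2) have "?P (A \<otimes>\<^bsub>qmat q\<^esub> B) (t * u)"
      by (simp add: Line.act_mult Torus.act_mult mult.assoc)
    then show ?case ..
  qed
  then show ?thesis by blast
qed

text \<open>
  Each of the three minors shifts its own exponent and rescales by a power of \<open>q\<close>, so the product
  sends the series \<open>1\<close> to a nonzero multiple of one monomial.
\<close>

lemma torus_act_monomial:
  fixes N :: nat
  defines "\<delta> \<equiv> \<lambda>m. if m = (0, 0, 0) then 1 else 0"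
  shows "Torus.act (qminor q 1 3 [^]\<^bsub>qmat q\<^esub> N \<otimes>\<^bsub>qmat q\<^esub> qminor q 1 4 [^]\<^bsub>qmat q\<^esub> N \<otimes>\<^bsub>qmat q\<^esub> qminor q 3 4)
    \<delta> (target (Suc N)) \<noteq> 0"
proof -
  interpret M: ring "qmat q" by (rule ring_qmat)
  show ?thesis
    using q_nonzero
    by (simp add: target_def \<delta>_def Torus.act_mult Torus.act_power torus_act_13_power torus_act_14_power
        torus_act_minor M.nat_pow_closed qminor_closed del: One_nat_def)
qed

end

section \<open>The syzygy and projectivity\<close>

text \<open>
  A vector with coefficients in \<open>A\<close> is a finite sum of multiples, by elements of \<open>A\<close>, of unit
  vectors.
\<close>

lemma linear_map_from_free_module_in:
  fixes S :: "('s, 'x) ring_scheme"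
  assumes "ring S" and h: "h \<in> linear_maps S (free_left_module S I) M"
    and v: "v \<in> carrier (free_left_module S I)"
    and A: "\<And>i. v i \<in> A" "\<zero>\<^bsub>S\<^esub> \<in> A"
    and Q_smult: "\<And>a m. a \<in> A \<Longrightarrow> m \<in> carrier M \<Longrightarrow> a \<odot>\<^bsub>M\<^esub> m \<in> Q"
    and Q_add: "\<And>x y. x \<in> Q \<Longrightarrow> y \<in> Q \<Longrightarrow> x \<oplus>\<^bsub>M\<^esub> y \<in> Q"
  shows "h v \<in> Q"
proof -
  interpret S: ring S by fact
  let ?F = "free_left_module S I"
  have F: "carrier ?F = {v. (\<forall>i. v i \<in> carrier S) \<and> (\<forall>i. i \<notin> I \<longrightarrow> v i = \<zero>\<^bsub>S\<^esub>) \<and> finite {i. v i \<noteq> \<zero>\<^bsub>S\<^esub>}}"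
    "add ?F = (\<lambda>v w i. v i \<oplus>\<^bsub>S\<^esub> w i)" "smult ?F = (\<lambda>s v i. s \<otimes>\<^bsub>S\<^esub> v i)"
    by (simp_all add: free_left_module_def)
  have h_add: "h (\<lambda>i. x i \<oplus>\<^bsub>S\<^esub> y i) = h x \<oplus>\<^bsub>M\<^esub> h y" if "x \<in> carrier ?F" "y \<in> carrier ?F" for x y
    using h that by (simp add: linear_maps_def F(2))
  have h_smult: "h (\<lambda>i. s \<otimes>\<^bsub>S\<^esub> x i) = s \<odot>\<^bsub>M\<^esub> h x" if "s \<in> carrier S" "x \<in> carrier ?F" for s x
    using h that by (simp add: linear_maps_def F(3))
  have h_closed: "h x \<in> carrier M" if "x \<in> carrier ?F" for x
    using h that by (auto simp: linear_maps_def)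
  have "finite {i. v i \<noteq> \<zero>\<^bsub>S\<^esub>}" using v by (simp add: F)
  then show ?thesis using v A(1)
  proof (induction "{i. v i \<noteq> \<zero>\<^bsub>S\<^esub>}" arbitrary: v rule: finite_psubset_induct)
    case psubset
    show ?case
    proof (cases "{i. v i \<noteq> \<zero>\<^bsub>S\<^esub>} = {}")
      case True
      have zero: "(\<lambda>i. \<zero>\<^bsub>S\<^esub>) \<in> carrier ?F" by (simp add: F)
      have "v = (\<lambda>i. \<zero>\<^bsub>S\<^esub> \<otimes>\<^bsub>S\<^esub> \<zero>\<^bsub>S\<^esub>)" using True by (auto simp: fun_eq_iff)
      then have "h v = \<zero>\<^bsub>S\<^esub> \<odot>\<^bsub>M\<^esub> h (\<lambda>i. \<zero>\<^bsub>S\<^esub>)" using h_smult [OF _ zero] by simp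
      then show ?thesis using Q_smult [OF A(2) h_closed [OF zero]] by simp
    next
      case False
      then obtain i where i: "v i \<noteq> \<zero>\<^bsub>S\<^esub>" by blast
      let ?w = "v(i := \<zero>\<^bsub>S\<^esub>)" and ?e = "\<lambda>j. if j = i then \<one>\<^bsub>S\<^esub> else \<zero>\<^bsub>S\<^esub>"
      have e: "?e \<in> carrier ?F" and se: "(\<lambda>j. v i \<otimes>\<^bsub>S\<^esub> ?e j) \<in> carrier ?F"
        using psubset(3) i by (auto simp: F)
      have "{j. ?w j \<noteq> \<zero>\<^bsub>S\<^esub>} \<subset> {j. v j \<noteq> \<zero>\<^bsub>S\<^esub>}" using i by auto
      moreover have w: "?w \<in> carrier ?F"
        using psubset(3) by (auto simp: F elim: rev_finite_subset)
      ultimately have "h ?w \<in> Q" using psubset(4) A(2) by (intro psubset(2)) auto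
      moreover have "v i \<odot>\<^bsub>M\<^esub> h ?e \<in> Q" using psubset(4) h_closed [OF e] by (intro Q_smult)
      moreover have "v = (\<lambda>j. ?w j \<oplus>\<^bsub>S\<^esub> v i \<otimes>\<^bsub>S\<^esub> ?e j)"
        using psubset(3) by (auto simp: F fun_eq_iff)
      then have "h v = h ?w \<oplus>\<^bsub>M\<^esub> v i \<odot>\<^bsub>M\<^esub> h ?e"
        using h_add [OF w se] h_smult [OF _ e] psubset(3) by (simp add: F)
      ultimately show ?thesis using Q_add by simp
    qed
  qed
qed

theorem theorem5p9:
  fixes q :: "'k::field" and l :: nat
  assumes "primitive_root_of_unity l q" and "l \<ge> 2"
  shows "\<not> frobenius_extension (qgrassmannian q) (l_centre q l)"
proof
  have ql: "q ^ l = 1" and q0: "q \<noteq> 0"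
    using assms by (auto simp: primitive_root_of_unity_def power_0_left)
  obtain N where l: "l = Suc N" using assms(2) by (cases l) auto
  interpret grassmannian_representations q by unfold_locales (rule q0)
  interpret M: quantum_two_rows "qmat q" "qmat_scalar q" q "{1..4}" "qmat_gen q 1" "qmat_gen q 2"
    by (rule quantum_two_rows_qmat [OF q0])
  let ?R = "qgrassmannian q" and ?Z = "l_centre q l"
  let ?S = "?R\<lparr>carrier := ?Z\<rparr>"
  interpret R: ring ?R by (rule ring_qgrassmannian)
  interpret S': ring ?S by (rule R.subring_is_ring [OF subring_l_centre])
  have R_ops [simp]: "monoid.mult ?R = monoid.mult (qmat q)" "add ?R = add (qmat q)"
    "\<one>\<^bsub>?R\<^esub> = \<one>\<^bsub>qmat q\<^esub>" "\<zero>\<^bsub>?R\<^esub> = \<zero>\<^bsub>qmat q\<^esub>"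
    by (simp_all add: qgrassmannian_def)
  note R_closed = R.m_closed [simplified R_ops] R.a_closed [simplified R_ops]

  define x y w where "x = qminor q 1 2" and "y = qminor q 1 3" and "w = qminor q 1 4"
  have gen: "qminor q i j \<in> carrier ?R" if "1 \<le> i" "i < j" "j \<le> 4" for i j
    using that unfolding qgrassmannian_def qmat_subalgebra_generated_def
    by (auto intro!: generate_ring.incl)
  have scalar: "qmat_scalar q a \<in> carrier ?R" for a
    unfolding qgrassmannian_def qmat_subalgebra_generated_def
    by (auto intro!: generate_ring.incl)
  have pow: "t [^]\<^bsub>qmat q\<^esub> n \<in> carrier ?R" if "t \<in> carrier ?R" for t and n :: nat
    using that by (induction n) (use R.one_closed in \<open>auto intro: R_closed\<close>)
  have Z_gen: "qminor q i j [^]\<^bsub>qmat q\<^esub> l \<in> ?Z" if "1 \<le> i" "i < j" "j \<le> 4" for i j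
    using that unfolding l_centre_def qmat_subalgebra_generated_def
    by (auto intro!: generate_ring.incl)
  have in_M: "x \<in> carrier (qmat q)" "y \<in> carrier (qmat q)" "w \<in> carrier (qmat q)"
    by (simp_all add: x_def y_def w_def qminor_closed)

  define r where "r = y [^]\<^bsub>qmat q\<^esub> N \<otimes>\<^bsub>qmat q\<^esub> w [^]\<^bsub>qmat q\<^esub> N \<otimes>\<^bsub>qmat q\<^esub> qminor q 3 4"
  have r_R: "r \<in> carrier ?R"
    by (auto simp: r_def y_def w_def intro!: R_closed pow gen)
  obtain A B where AB: "A \<in> carrier ?R" "B \<in> carrier ?R"
    and syzygy: "x [^]\<^bsub>qmat q\<^esub> l \<otimes>\<^bsub>qmat q\<^esub> r =
      y [^]\<^bsub>qmat q\<^esub> l \<otimes>\<^bsub>qmat q\<^esub> A \<oplus>\<^bsub>qmat q\<^esub> w [^]\<^bsub>qmat q\<^esub> l \<otimes>\<^bsub>qmat q\<^esub> B"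
  proof -
    have minor: "M.minor i j = qminor q i j" if "1 \<le> i" "i \<le> 4" "1 \<le> j" "j \<le> 4" for i j
      using that by (rule minor_eq_qminor [OF q0])
    have "\<exists>a b. M.minor 1 2 [^]\<^bsub>qmat q\<^esub> Suc N \<otimes>\<^bsub>qmat q\<^esub>
        (M.minor 1 3 [^]\<^bsub>qmat q\<^esub> N \<otimes>\<^bsub>qmat q\<^esub> M.minor 1 4 [^]\<^bsub>qmat q\<^esub> N \<otimes>\<^bsub>qmat q\<^esub> M.minor 3 4) =
      M.minor 1 3 [^]\<^bsub>qmat q\<^esub> Suc N \<otimes>\<^bsub>qmat q\<^esub>
        M.smul a (M.minor 1 4 [^]\<^bsub>qmat q\<^esub> N \<otimes>\<^bsub>qmat q\<^esub> M.minor 1 2 [^]\<^bsub>qmat q\<^esub> N \<otimes>\<^bsub>qmat q\<^esub> M.minor 2 4)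
      \<oplus>\<^bsub>qmat q\<^esub> M.minor 1 4 [^]\<^bsub>qmat q\<^esub> Suc N \<otimes>\<^bsub>qmat q\<^esub>
        M.smul b (M.minor 1 3 [^]\<^bsub>qmat q\<^esub> N \<otimes>\<^bsub>qmat q\<^esub> M.minor 1 2 [^]\<^bsub>qmat q\<^esub> N \<otimes>\<^bsub>qmat q\<^esub> M.minor 2 3)"
      by (rule M.minor_syzygy) (use ql l in auto)
    then obtain a b where *: "x [^]\<^bsub>qmat q\<^esub> l \<otimes>\<^bsub>qmat q\<^esub> r =
      y [^]\<^bsub>qmat q\<^esub> l \<otimes>\<^bsub>qmat q\<^esub>
        M.smul a (w [^]\<^bsub>qmat q\<^esub> N \<otimes>\<^bsub>qmat q\<^esub> x [^]\<^bsub>qmat q\<^esub> N \<otimes>\<^bsub>qmat q\<^esub> qminor q 2 4)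
      \<oplus>\<^bsub>qmat q\<^esub> w [^]\<^bsub>qmat q\<^esub> l \<otimes>\<^bsub>qmat q\<^esub>
        M.smul b (y [^]\<^bsub>qmat q\<^esub> N \<otimes>\<^bsub>qmat q\<^esub> x [^]\<^bsub>qmat q\<^esub> N \<otimes>\<^bsub>qmat q\<^esub> qminor q 2 3)"
      by (auto simp: minor x_def y_def w_def r_def l simp del: One_nat_def)
    show ?thesis
      by (rule that [OF _ _ *]) (auto simp: M.smul_def x_def y_def w_def intro!: R_closed pow gen scalar)
  qed

  assume "frobenius_extension ?R ?Z"
  then obtain I :: "((nat \<times> nat) list \<Rightarrow> 'k) set set" and \<iota> \<pi> where
    iota: "\<iota> \<in> linear_maps ?S (ring_bimodule ?R) (free_left_module ?S I)" and
    pi: "\<pi> \<in> linear_maps ?S (free_left_module ?S I) (ring_bimodule ?R)" and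
    inverse: "\<forall>t\<in>carrier (ring_bimodule ?R). \<pi> (\<iota> t) = t"
    unfolding frobenius_extension_def projective_left_module_def by blast
  have retract: "\<pi> (\<iota> t) = t" if "t \<in> carrier ?R" for t
    using inverse that by (simp add: ring_bimodule_def)
  \<comment> \<open>The coordinates of \<open>\<iota> t\<close> are the functionals \<open>\<phi>\<^sub>i\<close> of the introduction.\<close>
  have coord_Z: "\<iota> t i \<in> ?Z" if "t \<in> carrier ?R" for t i
    using iota that by (auto simp: linear_maps_def free_left_module_def ring_bimodule_def Pi_iff PiE_iff)
  have coord_add: "\<iota> (t \<oplus>\<^bsub>qmat q\<^esub> u) i = \<iota> t i \<oplus>\<^bsub>qmat q\<^esub> \<iota> u i"
    if "t \<in> carrier ?R" "u \<in> carrier ?R" for t u i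
    using iota that by (auto simp: linear_maps_def free_left_module_def ring_bimodule_def)
  have coord_mult: "\<iota> (z \<otimes>\<^bsub>qmat q\<^esub> t) i = z \<otimes>\<^bsub>qmat q\<^esub> \<iota> t i"
    if "z \<in> ?Z" "t \<in> carrier ?R" for z t i
    using iota that by (auto simp: linear_maps_def free_left_module_def ring_bimodule_def)

  have Z_closed: "z \<in> carrier (qmat q)" if "z \<in> ?Z" for z
    using that by (intro grassmannian_closed l_centre_closed)
  \<comment> \<open>The elements of the \<open>l\<close>-centre with constant term \<open>0\<close>, as far as the second representation
    sees them at the exponents of \<open>r\<close>.\<close>
  define K where "K = {c \<in> ?Z. \<forall>v\<in>octant. Torus.act c v (target l) = 0}"
  have coord_K: "\<iota> r i \<in> K" for i
  proof -
    let ?c = "\<iota> r i" and ?\<delta> = "\<lambda>n. if n = 0 then 1 else 0 :: 'k"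
    have xZ: "x [^]\<^bsub>qmat q\<^esub> l \<in> ?Z" and yZ: "y [^]\<^bsub>qmat q\<^esub> l \<in> ?Z" and wZ: "w [^]\<^bsub>qmat q\<^esub> l \<in> ?Z"
      unfolding x_def y_def w_def by (rule Z_gen; simp)+
    obtain t where line_t: "\<And>v. Line.act ?c v 0 = t * v 0"
      and torus_t: "\<And>v. v \<in> octant \<Longrightarrow> Torus.act ?c v (target l) = t * v (target l)"
      using l_centre_constant_term [OF assms(2) coord_Z [OF r_R]] by blast
    have "x [^]\<^bsub>qmat q\<^esub> l \<otimes>\<^bsub>qmat q\<^esub> ?c = \<iota> (x [^]\<^bsub>qmat q\<^esub> l \<otimes>\<^bsub>qmat q\<^esub> r) i"
      using xZ r_R by (simp add: coord_mult)
    also have "\<dots> = y [^]\<^bsub>qmat q\<^esub> l \<otimes>\<^bsub>qmat q\<^esub> \<iota> A i \<oplus>\<^bsub>qmat q\<^esub> w [^]\<^bsub>qmat q\<^esub> l \<otimes>\<^bsub>qmat q\<^esub> \<iota> B i"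
      using yZ wZ AB unfolding syzygy
      by (simp add: coord_mult coord_add R_closed l_centre_closed)
    finally have eq: "x [^]\<^bsub>qmat q\<^esub> l \<otimes>\<^bsub>qmat q\<^esub> ?c =
      y [^]\<^bsub>qmat q\<^esub> l \<otimes>\<^bsub>qmat q\<^esub> \<iota> A i \<oplus>\<^bsub>qmat q\<^esub> w [^]\<^bsub>qmat q\<^esub> l \<otimes>\<^bsub>qmat q\<^esub> \<iota> B i" .
    \<comment> \<open>In degree \<open>l\<close>, the left-hand side shows the constant term of \<open>?c\<close>, moved up from degree \<open>0\<close>,
      while \<open>y\<close> and \<open>w\<close> act by zero.\<close>
    have "Line.act (x [^]\<^bsub>qmat q\<^esub> l \<otimes>\<^bsub>qmat q\<^esub> ?c) ?\<delta> l = Line.act ?c ?\<delta> 0"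
      using in_M coord_Z [OF r_R] Z_closed
      by (simp add: Line.act_mult Line.act_power x_def line_act_12_power del: One_nat_def)
    moreover have "Line.act (y [^]\<^bsub>qmat q\<^esub> l \<otimes>\<^bsub>qmat q\<^esub> \<iota> A i \<oplus>\<^bsub>qmat q\<^esub> w [^]\<^bsub>qmat q\<^esub> l \<otimes>\<^bsub>qmat q\<^esub> \<iota> B i) ?\<delta> l = 0"
      using in_M coord_Z AB Z_closed assms(2)
      by (simp add: Line.act_add Line.act_mult Line.act_power y_def w_def funpow_vanishes line_act_minor del: One_nat_def)
    ultimately have "t = 0" using eq line_t [of ?\<delta>] by simp
    then show ?thesis using torus_t coord_Z [OF r_R] by (simp add: K_def)
  qed

  define \<delta> where "\<delta> = (\<lambda>m :: int \<times> int \<times> int. if m = (0, 0, 0) then 1 else 0 :: 'k)"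
  have \<delta>: "\<delta> \<in> octant" by (simp add: \<delta>_def octant_def)
  \<comment> \<open>So \<open>r\<close> is a sum of products \<open>c p\<close> with \<open>c\<close> in \<open>K\<close>, and \<open>p\<close> sends the series \<open>\<delta> = 1\<close> to a power series,
    whose coefficient at the exponents of \<open>r\<close> is then annihilated by \<open>c\<close>.\<close>
  have "\<pi> (\<iota> r) \<in> {u \<in> carrier ?R. Torus.act u \<delta> (target l) = 0}"
  proof (rule linear_map_from_free_module_in [OF S'.ring_axioms pi, where A = K])
    show "\<iota> r \<in> carrier (free_left_module ?S I)"
      using iota r_R by (auto simp: linear_maps_def ring_bimodule_def)
    show "\<zero>\<^bsub>?S\<^esub> \<in> K"
      using S'.zero_closed by (simp add: K_def Torus.act_zero)
    show "\<iota> r i \<in> K" for i by (rule coord_K)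
  qed (use \<delta> in \<open>auto simp: K_def ring_bimodule_def l_centre_closed R_closed grassmannian_closed
      Z_closed Torus.act_mult Torus.act_add torus_act_grassmannian_octant\<close>)
  then have "Torus.act r \<delta> (target l) = 0" using retract r_R by simp
  moreover have "Torus.act r \<delta> (target l) \<noteq> 0"
    using torus_act_monomial unfolding r_def y_def w_def l \<delta>_def .
  ultimately show False by simp
qed

end
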